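(* Let $(M,\langle\cdot,\cdot\rangle,J)$ be a $2n$-dimensional K\"ahler manifold with scalar curvature $\mathrm{R}$, endowed with its canonical $\mathrm{Spin}^c$ ($=\mathrm{Spin}^2$) structure with canonical connection $\theta$. Let $\phi$ be the parallel twisted spinor field in $S(M,F,1)$ corresponding to the complex structure, given at each point, in suitable frames, by $\phi=u_{-1}\otimes\cdots\otimes u_{-1}\otimes v_1\in\Delta_{2n}\otimes\Delta_2^+$ (so that $\hat\eta^\phi_{12}=J$). Then $$\Theta=-R^M\bullet\eta^\phi,$$ so that the pair $(\phi,\theta)$ satisfies the Clifford monopole equations $\partial\!\!\!/^{\,\theta}\phi=0$, $\Theta=E(\eta^\phi)$ with $E=-R^M\bullet$. If moreover $M$ is Einstein, then $\Theta=\frac{\mathrm{R}}{2n}\eta^\phi$; and if in addition $\mathrm{R}$ is constant, then (i) if $\mathrm{R}\ge0$, the pair $\big(\sqrt{\tfrac{\mathrm{R}}{2n}}\,\phi,\theta\big)$ satisfies the Clifford monopole equations with $E=\mathrm{Id}_{\bigwedge^2T^*M}$; (ii) if $\mathrm{R}\le0$, the pair $\big(\sqrt{\tfrac{-\mathrm{R}}{2n}}\,\phi,\theta\big)$ satisfies the Clifford monopole equations with $E=-\mathrm{Id}_{\bigwedge^2T^*M}$.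
   Context: Canonical $\mathrm{Spin}^c$ structure: the one induced by the canonical lift $\mathrm{U}(n)\to\mathrm{Spin}^c(2n)$, for which the spinor bundle is $S(TM)\otimes\kappa_M^{-1/2}=\bigwedge^{0,0}\oplus\cdots\oplus\bigwedge^{0,n}$, where $\kappa_M=\bigwedge^{n,0}$; $\phi$ is a unit-length parallel section of the trivial summand $\bigwedge^{0,0}$, and $\theta$ is the connection on the auxiliary bundle induced by the Levi-Civita connection. Here $\mathrm{U}(1)=\mathrm{Spin}(2)$, $F$ is the associated auxiliary oriented rank $2$ Riemannian bundle with local oriented orthonormal frame $(f_1,f_2)$, $f_{12}=f_1f_2$, $\Delta_2=\Delta_2^+\oplus\Delta_2^-$ with $f_{12}$ acting as $\pm\mathrm{i}$ on $\Delta_2^\pm$, $v_1$ is a unit vector of $\Delta_2^+$, and $S(M,F,1)$ is the twisted spinor bundle with fibre $\Delta_{2n}\otimes\Delta_2$, in which $S(TM)\otimes\kappa_M^{-1/2}$ is the part with fibre $\Delta_{2n}\otimes\Delta_2^+$. $\Delta_{2n}=(\mathbb{C}^2)^{\otimes n}$ is the complex spinor module with Clifford multiplication ($e_ie_j+e_je_i=-2\delta_{ij}$) for which $u_{-1}\otimes\cdots\otimes u_{-1}$ is the unit spinor satisfying $e_{2j-1}e_{2j}\cdot(u_{-1}\otimes\cdots\otimes u_{-1})=-\mathrm{i}\,(u_{-1}\otimes\cdots\otimes u_{-1})$ for all $j$, where $(e_1,\dots,e_{2n})$ is an orthonormal frame with $Je_{2j-1}=e_{2j}$. The Hermitian product makes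 vectors act skew-Hermitianly. For a twisted spinor $\phi$: $\eta_{12}^\phi(X,Y)=\mathrm{Re}\langle X\wedge Y\cdot f_{12}\cdot\phi,\phi\rangle$ (with $X\wedge Y=X\cdot Y+\langle X,Y\rangle$ acting on the first factor and $f_{12}$ on the second), $\langle\hat\eta_{12}^\phi(X),Y\rangle=\eta_{12}^\phi(X,Y)$, and $\eta^\phi=\eta_{12}^\phi\otimes f_{12}\in\Gamma(\bigwedge^2T^*M\otimes\bigwedge^2F)$. The curvature of $\theta$ is $\Theta=\Theta_{12}\otimes f_{12}$ with $\Theta_{12}(X,Y)=\langle R^F(X,Y)f_2,f_1\rangle$. $\nabla^\theta$ is the covariant derivative on $S(M,F,1)$ induced by the Levi-Civita connection and $\theta$, and $\partial\!\!\!/^{\,\theta}\phi=\sum_ie_i\cdot\nabla^\theta_{e_i}\phi$. $R^M(X,Y,Z,W)=\langle R^M(X,Y)Z,W\rangle$ is the Riemannian curvature, and $R^M\bullet$ acts on $2$-forms by $(R^M\bullet\eta)(X,Y)=\sum_{a<b}R^M(X,Y,e_a,e_b)\,\eta(e_a,e_b)$. $E$ denotes an endomorphism of $2$-forms applied to the $\bigwedge^2T^*M$ factor. *)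

theory Defs
  imports "HOL-Analysis.Analysis"
begin

section \<open>Smooth manifolds of real dimension 2n\<close>

text \<open>
  The model space of a 2n-dimensional manifold is complex n-space viewed as a real Euclidean space
  of dimension 2n, where n is the cardinality of the (linearly ordered) index type. The library
  inner product on it is the real part of the standard Hermitian product. The indices 2j-1 and 2j
  of the standard basis are encoded as (j, False) and (j, True); thus multiplication by the
  imaginary unit sends the vector number 2j-1 to the vector number 2j.
\<close>

type_synonym 'n cvec = "(complex, 'n) vec"
type_synonym 'n cmat = "((complex, 'n) vec, 'n) vec"

definition ebas :: "'n::finite \<times> bool \<Rightarrow> 'n cvec" where
  "ebas a = axis (fst a) (if snd a then \<i> else 1)"

definition idx_less :: "'n::linorder \<times> bool \<Rightarrow> 'n \<times> bool \<Rightarrow> bool" where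
  "idx_less a b \<longleftrightarrow> fst a < fst b \<or> fst a = fst b \<and> snd a < snd b"

primrec Ck_on ::
  "nat \<Rightarrow> ('e::euclidean_space \<Rightarrow> 'f::real_normed_vector) \<Rightarrow> 'e set \<Rightarrow> bool" where
  "Ck_on 0 f S \<longleftrightarrow> continuous_on S f"
| "Ck_on (Suc k) f S \<longleftrightarrow>
     (\<forall>x\<in>S. f differentiable (at x)) \<and> (\<forall>v. Ck_on k (\<lambda>x. frechet_derivative f (at x) v) S)"

text \<open>Intended for open domains only.\<close>

definition smooth_on :: "('e::euclidean_space \<Rightarrow> 'f::real_normed_vector) \<Rightarrow> 'e set \<Rightarrow> bool" where
  "smooth_on f S \<longleftrightarrow> (\<forall>k. Ck_on k f S)"

type_synonym ('a, 'n) chart = "'a set \<times> ('a \<Rightarrow> 'n cvec)"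

definition chart_inv :: "('a, 'n::finite) chart \<Rightarrow> 'n cvec \<Rightarrow> 'a" where
  "chart_inv C = inv_into (fst C) (snd C)"

definition is_chart :: "('a::topological_space, 'n::finite) chart \<Rightarrow> bool" where
  "is_chart C \<longleftrightarrow> open (fst C) \<and> open (snd C ` fst C) \<and>
     homeomorphism (fst C) (snd C ` fst C) (snd C) (chart_inv C)"

text \<open>The manifold is the whole type; an atlas (not necessarily maximal) gives its smooth structure.\<close>

definition smooth_atlas ::
  "('a::{t2_space, second_countable_topology}, 'n::finite) chart set \<Rightarrow> bool" where
  "smooth_atlas \<A> \<longleftrightarrow>
     (\<forall>C\<in>\<A>. is_chart C) \<and> (\<Union>C\<in>\<A>. fst C) = UNIV \<and>
     (\<forall>C\<in>\<A>. \<forall>D\<in>\<A>. smooth_on (snd D \<circ> chart_inv C) (snd C ` (fst C \<inter> fst D)))"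

definition smooth_in ::
  "('a, 'n::finite) chart \<Rightarrow> 'a set \<Rightarrow> ('a \<Rightarrow> 'f::real_normed_vector) \<Rightarrow> bool" where
  "smooth_in C V f \<longleftrightarrow> smooth_on (f \<circ> chart_inv C) (snd C ` V)"

text \<open>Derivative at p of a function on the manifold, along the tangent vector with components X.\<close>

definition pderiv_in ::
  "('a, 'n::finite) chart \<Rightarrow> ('a \<Rightarrow> 'f::real_normed_vector) \<Rightarrow> 'n cvec \<Rightarrow> 'a \<Rightarrow> 'f" where
  "pderiv_in C f X p = frechet_derivative (f \<circ> chart_inv C) (at (snd C p)) X"

definition jac ::
  "('a, 'n::finite) chart \<Rightarrow> ('a, 'n) chart \<Rightarrow> 'a \<Rightarrow> 'n cvec \<Rightarrow> 'n cvec" where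
  "jac C D p = frechet_derivative (snd D \<circ> chart_inv C) (at (snd C p))"

definition hess ::
  "('a, 'n::finite) chart \<Rightarrow> ('a, 'n) chart \<Rightarrow> 'a \<Rightarrow> 'n cvec \<Rightarrow> 'n cvec \<Rightarrow> 'n cvec" where
  "hess C D p X Y =
     frechet_derivative (\<lambda>x. frechet_derivative (snd D \<circ> chart_inv C) (at x) Y) (at (snd C p)) X"


section \<open>Kaehler manifolds\<close>

text \<open>
  A tensor field is the family of its components: in each chart of the atlas, at each point of the
  domain of the chart, a multilinear map on the model space, subject to the tensorial
  transformation law under the Jacobians of the changes of charts.
\<close>

type_synonym ('a, 'n) form2 = "('a, 'n) chart \<Rightarrow> 'a \<Rightarrow> 'n cvec \<Rightarrow> 'n cvec \<Rightarrow> real"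
type_synonym ('a, 'n) endo = "('a, 'n) chart \<Rightarrow> 'a \<Rightarrow> 'n cvec \<Rightarrow> 'n cvec"
type_synonym ('a, 'n) conn =
  "('a, 'n) chart \<Rightarrow> 'a \<Rightarrow> 'n cvec \<Rightarrow> 'n cvec \<Rightarrow> 'n cvec"

definition riemannian_metric ::
  "('a, 'n::finite) chart set \<Rightarrow> ('a, 'n) form2 \<Rightarrow> bool" where
  "riemannian_metric \<A> g \<longleftrightarrow>
     (\<forall>C\<in>\<A>. \<forall>p\<in>fst C. bilinear (g C p) \<and> (\<forall>X Y. g C p X Y = g C p Y X) \<and>
        (\<forall>X. X \<noteq> 0 \<longrightarrow> g C p X X > 0)) \<and>
     (\<forall>C\<in>\<A>. \<forall>X Y. smooth_in C (fst C) (\<lambda>p. g C p X Y)) \<and>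
     (\<forall>C\<in>\<A>. \<forall>D\<in>\<A>. \<forall>p\<in>fst C \<inter> fst D. \<forall>X Y.
        g D p (jac C D p X) (jac C D p Y) = g C p X Y)"

definition almost_complex_structure ::
  "('a, 'n::finite) chart set \<Rightarrow> ('a, 'n) endo \<Rightarrow> bool" where
  "almost_complex_structure \<A> J \<longleftrightarrow>
     (\<forall>C\<in>\<A>. \<forall>p\<in>fst C. linear (J C p) \<and> (\<forall>X. J C p (J C p X) = - X)) \<and>
     (\<forall>C\<in>\<A>. \<forall>X. smooth_in C (fst C) (\<lambda>p. J C p X)) \<and>
     (\<forall>C\<in>\<A>. \<forall>D\<in>\<A>. \<forall>p\<in>fst C \<inter> fst D. \<forall>X. J D p (jac C D p X) = jac C D p (J C p X))"

text \<open>
  A connection on the tangent bundle is given by its Christoffel symbols in the charts. The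
  covariant derivative at p along X of a vector field with components Y is cov below.
\<close>

definition affine_connection ::
  "('a, 'n::finite) chart set \<Rightarrow> ('a, 'n) conn \<Rightarrow> bool" where
  "affine_connection \<A> \<Gamma> \<longleftrightarrow>
     (\<forall>C\<in>\<A>. \<forall>p\<in>fst C. bilinear (\<Gamma> C p)) \<and>
     (\<forall>C\<in>\<A>. \<forall>X Y. smooth_in C (fst C) (\<lambda>p. \<Gamma> C p X Y)) \<and>
     (\<forall>C\<in>\<A>. \<forall>D\<in>\<A>. \<forall>p\<in>fst C \<inter> fst D. \<forall>X Y.
        \<Gamma> D p (jac C D p X) (jac C D p Y) = jac C D p (\<Gamma> C p X Y) - hess C D p X Y)"

definition cov ::
  "('a, 'n::finite) conn \<Rightarrow> ('a, 'n) chart \<Rightarrow> 'n cvec \<Rightarrow> ('a \<Rightarrow> 'n cvec) \<Rightarrow> 'a \<Rightarrow> 'n cvec" where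
  "cov \<Gamma> C X Y p = pderiv_in C Y X p + \<Gamma> C p X (Y p)"

text \<open>
  The Levi-Civita connection is the torsion-free metric connection. On fields with constant
  components in a chart the Lie brackets vanish, so torsion-freeness is symmetry of the
  Christoffel symbols.
\<close>

definition levi_civita ::
  "('a, 'n::finite) chart set \<Rightarrow> ('a, 'n) form2 \<Rightarrow> ('a, 'n) conn \<Rightarrow> bool" where
  "levi_civita \<A> g \<Gamma> \<longleftrightarrow> affine_connection \<A> \<Gamma> \<and>
     (\<forall>C\<in>\<A>. \<forall>p\<in>fst C. \<forall>X Y. \<Gamma> C p X Y = \<Gamma> C p Y X) \<and>
     (\<forall>C\<in>\<A>. \<forall>p\<in>fst C. \<forall>X Y Z.
        pderiv_in C (\<lambda>q. g C q Y Z) X p = g C p (\<Gamma> C p X Y) Z + g C p Y (\<Gamma> C p X Z))"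

text \<open>
  Kaehler: J is orthogonal and parallel for the Levi-Civita connection \<Gamma>. The last clause is
  the vanishing of the covariant derivative of J, evaluated on fields Y with constant components.
\<close>

definition kaehler_manifold ::
  "('a::{t2_space, second_countable_topology}, 'n::finite) chart set \<Rightarrow> ('a, 'n) form2 \<Rightarrow>
   ('a, 'n) endo \<Rightarrow> ('a, 'n) conn \<Rightarrow> bool" where
  "kaehler_manifold \<A> g J \<Gamma> \<longleftrightarrow>
     smooth_atlas \<A> \<and> riemannian_metric \<A> g \<and> almost_complex_structure \<A> J \<and> levi_civita \<A> g \<Gamma> \<and>
     (\<forall>C\<in>\<A>. \<forall>p\<in>fst C. \<forall>X Y. g C p (J C p X) (J C p Y) = g C p X Y) \<and>
     (\<forall>C\<in>\<A>. \<forall>p\<in>fst C. \<forall>X Y.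
        cov \<Gamma> C X (\<lambda>q. J C q Y) p = J C p (cov \<Gamma> C X (\<lambda>_. Y) p))"

text \<open>
  R(X,Y)Z is the commutator of the covariant derivatives, computed on the extensions of X, Y, Z
  with constant components in the chart (for which [X,Y] = 0).
\<close>

definition riem ::
  "('a, 'n::finite) conn \<Rightarrow> ('a, 'n) chart \<Rightarrow> 'a \<Rightarrow> 'n cvec \<Rightarrow> 'n cvec \<Rightarrow> 'n cvec \<Rightarrow> 'n cvec" where
  "riem \<Gamma> C p X Y Z =
     cov \<Gamma> C X (cov \<Gamma> C Y (\<lambda>_. Z)) p - cov \<Gamma> C Y (cov \<Gamma> C X (\<lambda>_. Z)) p"

definition riem4 ::
  "('a, 'n::finite) form2 \<Rightarrow> ('a, 'n) conn \<Rightarrow> ('a, 'n) chart \<Rightarrow> 'a \<Rightarrow>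
   'n cvec \<Rightarrow> 'n cvec \<Rightarrow> 'n cvec \<Rightarrow> 'n cvec \<Rightarrow> real" where
  "riem4 g \<Gamma> C p X Y Z W = g C p (riem \<Gamma> C p X Y Z) W"

text \<open>Ric(Y,Z) is the trace of X \<mapsto> R(X,Y)Z; the trace may be taken in any basis.\<close>

definition ricci :: "('a, 'n::finite) conn \<Rightarrow> ('a, 'n) form2" where
  "ricci \<Gamma> C p Y Z = (\<Sum>b\<in>Basis. riem \<Gamma> C p b Y Z \<bullet> b)"

definition einstein ::
  "('a, 'n::finite) chart set \<Rightarrow> ('a, 'n) form2 \<Rightarrow> ('a, 'n) conn \<Rightarrow> bool" where
  "einstein \<A> g \<Gamma> \<longleftrightarrow>
     (\<exists>lam. \<forall>C\<in>\<A>. \<forall>p\<in>fst C. \<forall>Y Z. ricci \<Gamma> C p Y Z = lam p * g C p Y Z)"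

definition orthonormal_frame ::
  "('a, 'n::finite) form2 \<Rightarrow> ('a, 'n) chart \<Rightarrow> 'a \<Rightarrow> ('n cvec \<Rightarrow> 'n cvec) \<Rightarrow> bool" where
  "orthonormal_frame g C p u \<longleftrightarrow> linear u \<and> (\<forall>v w. g C p (u v) (u w) = v \<bullet> w)"

definition some_frame ::
  "('a, 'n::finite) form2 \<Rightarrow> ('a, 'n) chart \<Rightarrow> 'a \<Rightarrow> 'n cvec \<Rightarrow> 'n cvec" where
  "some_frame g C p = (SOME u. orthonormal_frame g C p u)"

definition scalar_curvature ::
  "('a, 'n::finite) form2 \<Rightarrow> ('a, 'n) conn \<Rightarrow> ('a, 'n) chart \<Rightarrow> 'a \<Rightarrow> real" where
  "scalar_curvature g \<Gamma> C p =
     (\<Sum>a\<in>UNIV. ricci \<Gamma> C p (some_frame g C p (ebas a)) (some_frame g C p (ebas a)))"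

text \<open>The endomorphism of 2-forms given by the curvature; it does not depend on the chosen frame.\<close>

definition curv_op ::
  "('a, 'n::{finite, linorder}) form2 \<Rightarrow> ('a, 'n) conn \<Rightarrow> ('a, 'n) chart \<Rightarrow> 'a \<Rightarrow>
   ('n cvec \<Rightarrow> 'n cvec \<Rightarrow> real) \<Rightarrow> 'n cvec \<Rightarrow> 'n cvec \<Rightarrow> real" where
  "curv_op g \<Gamma> C p \<eta> X Y = (let e = (\<lambda>a. some_frame g C p (ebas a)) in
     \<Sum>(a, b)\<in>{(a, b). idx_less a b}. riem4 g \<Gamma> C p X Y (e a) (e b) * \<eta> (e a) (e b))"


section \<open>Twisted spinors and the canonical lift\<close>

text \<open>
  All spinors are written in the orthonormal basis of tensor products of the vectors u_{+1}, u_{-1}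
  of \<open>\<complex>\<^sup>2\<close> (indices True and False), on which
    g_1 u_s = i u_{-s},  g_2 u_s = s u_{-s},  T u_s = -s u_s.
  The generator 2j-1 (resp. 2j) acts by g_1 (resp. g_2) on the factor j and by T on the factors
  k < j.
\<close>

definition gmat :: "bool \<Rightarrow> bool \<Rightarrow> bool \<Rightarrow> complex" where
  "gmat s a b = (if a = b then 0 else if \<not> s then \<i> else if b then 1 else -1)"

definition tmat :: "bool \<Rightarrow> bool \<Rightarrow> complex" where
  "tmat a b = (if a \<noteq> b then 0 else if b then -1 else 1)"

definition idmat :: "bool \<Rightarrow> bool \<Rightarrow> complex" where
  "idmat a b = (if a = b then 1 else 0)"

definition clifford_gen :: "'n::{finite, linorder} \<times> bool \<Rightarrow> complex^('n \<Rightarrow> bool)^('n \<Rightarrow> bool)" where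
  "clifford_gen a = (\<chi> \<alpha> \<beta>. \<Prod>k\<in>UNIV.
     (if k = fst a then gmat (snd a) else if k < fst a then tmat else idmat) (\<alpha> k) (\<beta> k))"

text \<open>
  Twisted spinors: the tensor product of the spinor modules of dimensions 2n and 2. The second
  index is True on the positive and False on the negative part of the latter.
\<close>

type_synonym 'n twisted = "(complex, ('n \<Rightarrow> bool) \<times> bool) vec"

definition cliff :: "('n::{finite, linorder}) cvec \<Rightarrow> 'n twisted \<Rightarrow> 'n twisted" where
  "cliff x \<psi> = (\<chi> m. \<Sum>\<beta>\<in>UNIV.
     (\<Sum>a\<in>UNIV. (x \<bullet> ebas a) *\<^sub>R clifford_gen a) $ fst m $ \<beta> * \<psi> $ (\<beta>, snd m))"

text \<open>Clifford multiplication by a vector of the plane, with f_1 = 1 and f_2 = i, on the second factor.\<close>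

definition fcliff :: "complex \<Rightarrow> 'n::{finite, linorder} twisted \<Rightarrow> 'n twisted" where
  "fcliff z \<psi> = (\<chi> m. \<Sum>t\<in>UNIV.
     (complex_of_real (Re z) * gmat False (snd m) t + complex_of_real (Im z) * gmat True (snd m) t)
       * \<psi> $ (fst m, t))"

definition f12 :: "'n::{finite, linorder} twisted \<Rightarrow> 'n twisted" where
  "f12 \<psi> = fcliff 1 (fcliff \<i> \<psi>)"

definition herm :: "'n::{finite, linorder} twisted \<Rightarrow> 'n twisted \<Rightarrow> complex" where
  "herm \<psi> \<xi> = (\<Sum>m\<in>UNIV. \<psi> $ m * cnj (\<xi> $ m))"

definition model_spinor :: "'n::{finite, linorder} twisted" where
  "model_spinor = axis ((\<lambda>_. False), True) 1"

text \<open>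
  The group Spin(2n) x Spin(2) modulo the diagonal sign, through its (faithful) representation on
  twisted spinors: products of an even number of unit vectors in each of the two factors.
\<close>

inductive_set spin_c :: "('n::{finite, linorder} twisted \<Rightarrow> 'n twisted) set" where
  spin_c_id: "id \<in> spin_c"
| spin_c_tangent: "h \<in> spin_c \<Longrightarrow> norm x = 1 \<Longrightarrow> norm y = 1 \<Longrightarrow> cliff x \<circ> cliff y \<circ> h \<in> spin_c"
| spin_c_aux: "h \<in> spin_c \<Longrightarrow> norm z = 1 \<Longrightarrow> norm w = 1 \<Longrightarrow> fcliff z \<circ> fcliff w \<circ> h \<in> spin_c"

definition unitary_group :: "('n::finite) cmat set" where
  "unitary_group = {A. A ** (\<chi> i j. cnj (A $ j $ i)) = mat 1}"

text \<open>
  The canonical lift is the (unique) continuous homomorphism from U(n) to the group above that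
  covers A \<mapsto> (A, det A) in SO(2n) x SO(2), the covering map being conjugation on vectors.
\<close>

definition canonical_lift ::
  "(('n::{finite, linorder}) cmat \<Rightarrow> 'n twisted \<Rightarrow> 'n twisted) \<Rightarrow> bool" where
  "canonical_lift \<sigma> \<longleftrightarrow>
     (\<forall>A\<in>unitary_group. \<sigma> A \<in> spin_c) \<and>
     (\<forall>A\<in>unitary_group. \<forall>B\<in>unitary_group. \<sigma> (A ** B) = \<sigma> A \<circ> \<sigma> B) \<and>
     (\<forall>\<psi>. continuous_on unitary_group (\<lambda>A. \<sigma> A \<psi>)) \<and>
     (\<forall>A\<in>unitary_group. \<forall>x \<psi>. \<sigma> A (cliff x \<psi>) = cliff (A *v x) (\<sigma> A \<psi>)) \<and>
     (\<forall>A\<in>unitary_group. \<forall>z \<psi>. \<sigma> A (fcliff z \<psi>) = fcliff (det A * z) (\<sigma> A \<psi>))"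


section \<open>The canonical structure and its bundles\<close>

text \<open>
  A unitary frame at p is a complex linear isometry u from the model space to the tangent space;
  its members are the vectors u (ebas a), so that J maps the member 2j-1 to the member 2j.
\<close>

definition unitary_frame ::
  "('a, 'n::finite) form2 \<Rightarrow> ('a, 'n) endo \<Rightarrow> ('a, 'n) chart \<Rightarrow> 'a \<Rightarrow> ('n cvec \<Rightarrow> 'n cvec) \<Rightarrow> bool" where
  "unitary_frame g J C p u \<longleftrightarrow>
     orthonormal_frame g C p u \<and> (\<forall>v. J C p (u v) = u (\<i> *s v))"

text \<open>Smooth local sections, over open V, of the bundle of unitary frames.\<close>

definition local_unitary_frame ::
  "('a::topological_space, 'n::finite) chart set \<Rightarrow> ('a, 'n) form2 \<Rightarrow> ('a, 'n) endo \<Rightarrow>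
   ('a, 'n) chart \<Rightarrow> 'a set \<Rightarrow> ('a \<Rightarrow> 'n cvec \<Rightarrow> 'n cvec) \<Rightarrow> bool" where
  "local_unitary_frame \<A> g J C V e \<longleftrightarrow>
     C \<in> \<A> \<and> open V \<and> V \<subseteq> fst C \<and> (\<forall>p\<in>V. unitary_frame g J C p (e p)) \<and>
     (\<forall>v. smooth_in C V (\<lambda>p. e p v))"

text \<open>
  The canonical structure is the extension of the bundle of unitary frames along the canonical
  lift. Hence the twisted spinor bundle is associated with the bundle of unitary frames through the
  lift, and its sections are the equivariant functions \<phi> C p u of unitary frames u at p (with
  components u in the chart C).
\<close>

type_synonym ('a, 'n) spinor_field =
  "('a, 'n) chart \<Rightarrow> 'a \<Rightarrow> ('n cvec \<Rightarrow> 'n cvec) \<Rightarrow> 'n twisted"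

definition twisted_spinor_field ::
  "('a::topological_space, 'n::{finite, linorder}) chart set \<Rightarrow> ('a, 'n) form2 \<Rightarrow> ('a, 'n) endo \<Rightarrow>
   ('n cmat \<Rightarrow> 'n twisted \<Rightarrow> 'n twisted) \<Rightarrow> ('a, 'n) spinor_field \<Rightarrow> bool" where
  "twisted_spinor_field \<A> g J \<sigma> \<phi> \<longleftrightarrow>
     (\<forall>C\<in>\<A>. \<forall>D\<in>\<A>. \<forall>p\<in>fst C \<inter> fst D. \<forall>u. unitary_frame g J C p u \<longrightarrow>
        \<phi> D p (jac C D p \<circ> u) = \<phi> C p u) \<and>
     (\<forall>C\<in>\<A>. \<forall>p\<in>fst C. \<forall>u. \<forall>A\<in>unitary_group. unitary_frame g J C p u \<longrightarrow>
        \<sigma> A (\<phi> C p (u \<circ> (*v) A)) = \<phi> C p u) \<and>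
     (\<forall>C V e. local_unitary_frame \<A> g J C V e \<longrightarrow> smooth_in C V (\<lambda>p. \<phi> C p (e p)))"

text \<open>
  The auxiliary plane bundle F is associated with the bundle of unitary frames through the
  determinant; a local unitary frame e trivializes it, with f_1 = 1 and f_2 = i in \<open>\<complex>\<close>. A connection
  on F is given by its connection forms \<theta> C e relative to local unitary frames e, so that the
  covariant derivative of a local section z is fcov below.
\<close>

type_synonym ('a, 'n) aux_conn =
  "('a, 'n) chart \<Rightarrow> ('a \<Rightarrow> 'n cvec \<Rightarrow> 'n cvec) \<Rightarrow> 'a \<Rightarrow> 'n cvec \<Rightarrow> complex"

definition fcov ::
  "('a, 'n::finite) aux_conn \<Rightarrow> ('a, 'n) chart \<Rightarrow> ('a \<Rightarrow> 'n cvec \<Rightarrow> 'n cvec) \<Rightarrow>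
   'n cvec \<Rightarrow> ('a \<Rightarrow> complex) \<Rightarrow> 'a \<Rightarrow> complex" where
  "fcov \<theta> C e X z p = pderiv_in C z X p + \<theta> C e p X * z p"

text \<open>
  The connection on F induced by \<Gamma>: its form is the image of the connection form of \<Gamma> in the
  frame e (a skew-Hermitian matrix, e being unitary and J parallel) under the trace, which is the
  differential of the determinant.
\<close>

definition canonical_aux_connection :: "('a, 'n::finite) conn \<Rightarrow> ('a, 'n) aux_conn" where
  "canonical_aux_connection \<Gamma> C e p X =
     trace (\<chi> i j. inv (e p) (cov \<Gamma> C X (\<lambda>q. e q (axis j 1)) p) $ i)"

definition aux_curvature ::
  "('a, 'n::finite) aux_conn \<Rightarrow> ('a, 'n) chart \<Rightarrow> ('a \<Rightarrow> 'n cvec \<Rightarrow> 'n cvec) \<Rightarrow> 'a \<Rightarrow>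
   'n cvec \<Rightarrow> 'n cvec \<Rightarrow> complex \<Rightarrow> complex" where
  "aux_curvature \<theta> C e p X Y z =
     fcov \<theta> C e X (fcov \<theta> C e Y (\<lambda>_. z)) p - fcov \<theta> C e Y (fcov \<theta> C e X (\<lambda>_. z)) p"

text \<open>
  \<open>\<Theta>\<^sub>1\<^sub>2(X,Y) = \<langle>R\<^sup>F(X,Y)f\<^sub>2, f\<^sub>1\<rangle>\<close>. Forms with values in \<open>\<And>\<^sup>2F\<close> are represented by their coefficient
  of \<open>f\<^sub>1\<^sub>2\<close>, which is a global section.
\<close>

definition Theta12 ::
  "('a, 'n::finite) aux_conn \<Rightarrow> ('a, 'n) chart \<Rightarrow> ('a \<Rightarrow> 'n cvec \<Rightarrow> 'n cvec) \<Rightarrow> 'a \<Rightarrow>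
   'n cvec \<Rightarrow> 'n cvec \<Rightarrow> real" where
  "Theta12 \<theta> C e p X Y = aux_curvature \<theta> C e p X Y \<i> \<bullet> 1"

text \<open>
  Connection forms \<open>\<omega>\<^sub>a\<^sub>b(X) = \<langle>\<nabla>\<^sub>X e\<^sub>a, e\<^sub>b\<rangle>\<close> and \<open>\<theta>\<^sub>1\<^sub>2(X) = \<langle>\<nabla>\<^sub>X f\<^sub>1, f\<^sub>2\<rangle>\<close>, and the covariant
  derivative on twisted spinors induced by \<Gamma> and \<theta>, in the trivialization given by e.
\<close>

definition omega ::
  "('a, 'n::finite) form2 \<Rightarrow> ('a, 'n) conn \<Rightarrow> ('a, 'n) chart \<Rightarrow> ('a \<Rightarrow> 'n cvec \<Rightarrow> 'n cvec) \<Rightarrow> 'a \<Rightarrow>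
   'n cvec \<Rightarrow> 'n \<times> bool \<Rightarrow> 'n \<times> bool \<Rightarrow> real" where
  "omega g \<Gamma> C e p X a b = g C p (cov \<Gamma> C X (\<lambda>q. e q (ebas a)) p) (e p (ebas b))"

definition theta12 ::
  "('a, 'n::finite) aux_conn \<Rightarrow> ('a, 'n) chart \<Rightarrow> ('a \<Rightarrow> 'n cvec \<Rightarrow> 'n cvec) \<Rightarrow> 'a \<Rightarrow>
   'n cvec \<Rightarrow> real" where
  "theta12 \<theta> C e p X = fcov \<theta> C e X (\<lambda>_. 1) p \<bullet> \<i>"

definition spin_cov ::
  "('a, 'n::{finite, linorder}) form2 \<Rightarrow> ('a, 'n) conn \<Rightarrow> ('a, 'n) aux_conn \<Rightarrow> ('a, 'n) spinor_field \<Rightarrow>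
   ('a, 'n) chart \<Rightarrow> ('a \<Rightarrow> 'n cvec \<Rightarrow> 'n cvec) \<Rightarrow> 'a \<Rightarrow> 'n cvec \<Rightarrow> 'n twisted" where
  "spin_cov g \<Gamma> \<theta> \<phi> C e p X =
     pderiv_in C (\<lambda>q. \<phi> C q (e q)) X p
     + (1/2) *\<^sub>R (\<Sum>(a, b)\<in>{(a, b). idx_less a b}.
         omega g \<Gamma> C e p X a b *\<^sub>R cliff (ebas a) (cliff (ebas b) (\<phi> C p (e p))))
     + (1/2 * theta12 \<theta> C e p X) *\<^sub>R f12 (\<phi> C p (e p))"

definition dirac ::
  "('a, 'n::{finite, linorder}) form2 \<Rightarrow> ('a, 'n) conn \<Rightarrow> ('a, 'n) aux_conn \<Rightarrow> ('a, 'n) spinor_field \<Rightarrow>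
   ('a, 'n) chart \<Rightarrow> ('a \<Rightarrow> 'n cvec \<Rightarrow> 'n cvec) \<Rightarrow> 'a \<Rightarrow> 'n twisted" where
  "dirac g \<Gamma> \<theta> \<phi> C e p =
     (\<Sum>a\<in>UNIV. cliff (ebas a) (spin_cov g \<Gamma> \<theta> \<phi> C e p (e p (ebas a))))"

definition parallel_spinor ::
  "('a::topological_space, 'n::{finite, linorder}) chart set \<Rightarrow> ('a, 'n) form2 \<Rightarrow> ('a, 'n) endo \<Rightarrow>
   ('a, 'n) conn \<Rightarrow> ('a, 'n) aux_conn \<Rightarrow> ('a, 'n) spinor_field \<Rightarrow> bool" where
  "parallel_spinor \<A> g J \<Gamma> \<theta> \<phi> \<longleftrightarrow>
     (\<forall>C V e. local_unitary_frame \<A> g J C V e \<longrightarrow>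
        (\<forall>p\<in>V. \<forall>X. spin_cov g \<Gamma> \<theta> \<phi> C e p X = 0))"

text \<open>Clifford multiplication on fibres; u is the unitary frame identifying the fibre with the model.\<close>

definition wedge_act ::
  "('a, 'n::{finite, linorder}) form2 \<Rightarrow> ('a, 'n) chart \<Rightarrow> 'a \<Rightarrow> ('n cvec \<Rightarrow> 'n cvec) \<Rightarrow>
   'n cvec \<Rightarrow> 'n cvec \<Rightarrow> 'n twisted \<Rightarrow> 'n twisted" where
  "wedge_act g C p u X Y \<psi> = cliff (inv u X) (cliff (inv u Y) \<psi>) + g C p X Y *\<^sub>R \<psi>"

definition eta12 ::
  "('a, 'n::{finite, linorder}) form2 \<Rightarrow> ('a, 'n) spinor_field \<Rightarrow> ('a, 'n) chart \<Rightarrow> 'a \<Rightarrow>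
   ('n cvec \<Rightarrow> 'n cvec) \<Rightarrow> 'n cvec \<Rightarrow> 'n cvec \<Rightarrow> real" where
  "eta12 g \<phi> C p u X Y = Re (herm (wedge_act g C p u X Y (f12 (\<phi> C p u))) (\<phi> C p u))"

definition eta12_hat ::
  "('a, 'n::{finite, linorder}) form2 \<Rightarrow> ('a, 'n) spinor_field \<Rightarrow> ('a, 'n) chart \<Rightarrow> 'a \<Rightarrow>
   ('n cvec \<Rightarrow> 'n cvec) \<Rightarrow> 'n cvec \<Rightarrow> 'n cvec" where
  "eta12_hat g \<phi> C p u X = (THE Z. \<forall>Y. g C p Z Y = eta12 g \<phi> C p u X Y)"

text \<open>
  The twisted spinor field corresponding to the complex structure: the section equal to the
  model spinor in all unitary frames.
\<close>

definition canonical_spinor ::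
  "('a::topological_space, 'n::{finite, linorder}) chart set \<Rightarrow> ('a, 'n) form2 \<Rightarrow> ('a, 'n) endo \<Rightarrow>
   ('n cmat \<Rightarrow> 'n twisted \<Rightarrow> 'n twisted) \<Rightarrow> ('a, 'n) spinor_field \<Rightarrow> bool" where
  "canonical_spinor \<A> g J \<sigma> \<phi> \<longleftrightarrow> twisted_spinor_field \<A> g J \<sigma> \<phi> \<and>
     (\<forall>C\<in>\<A>. \<forall>p\<in>fst C. \<forall>u. unitary_frame g J C p u \<longrightarrow> \<phi> C p u = model_spinor)"

text \<open>
  The equation \<open>\<Theta> = E \<eta>\<close> for an endomorphism E of 2-forms, acting on the coefficient of \<open>f\<^sub>1\<^sub>2\<close>.
  Relations between local expressions are required in all local unitary frames.
\<close>

definition curvature_eq ::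
  "('a::topological_space, 'n::{finite, linorder}) chart set \<Rightarrow> ('a, 'n) form2 \<Rightarrow> ('a, 'n) endo \<Rightarrow>
   ('a, 'n) aux_conn \<Rightarrow>
   (('a, 'n) chart \<Rightarrow> 'a \<Rightarrow> ('n cvec \<Rightarrow> 'n cvec \<Rightarrow> real) \<Rightarrow> 'n cvec \<Rightarrow> 'n cvec \<Rightarrow> real) \<Rightarrow>
   ('a, 'n) spinor_field \<Rightarrow> bool" where
  "curvature_eq \<A> g J \<theta> E \<phi> \<longleftrightarrow>
     (\<forall>C V e. local_unitary_frame \<A> g J C V e \<longrightarrow>
        (\<forall>p\<in>V. \<forall>X Y. Theta12 \<theta> C e p X Y = E C p (eta12 g \<phi> C p (e p)) X Y))"

definition clifford_monopole ::
  "('a::topological_space, 'n::{finite, linorder}) chart set \<Rightarrow> ('a, 'n) form2 \<Rightarrow> ('a, 'n) endo \<Rightarrow>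
   ('a, 'n) conn \<Rightarrow>
   (('a, 'n) chart \<Rightarrow> 'a \<Rightarrow> ('n cvec \<Rightarrow> 'n cvec \<Rightarrow> real) \<Rightarrow> 'n cvec \<Rightarrow> 'n cvec \<Rightarrow> real) \<Rightarrow>
   ('a, 'n) spinor_field \<Rightarrow> ('a, 'n) aux_conn \<Rightarrow> bool" where
  "clifford_monopole \<A> g J \<Gamma> E \<phi> \<theta> \<longleftrightarrow>
     (\<forall>C V e. local_unitary_frame \<A> g J C V e \<longrightarrow> (\<forall>p\<in>V. dirac g \<Gamma> \<theta> \<phi> C e p = 0)) \<and>
     curvature_eq \<A> g J \<theta> E \<phi>"

end

theory Submission
  imports Defs
begin

text \<open>
  In every unitary frame the spinor has constant components and
  \<open>e\<^sub>2\<^sub>j \<phi> = \<i> e\<^sub>2\<^sub>j\<^sub>-\<^sub>1 \<phi>\<close>, so the Levi-Civita connection, which is skew-Hermitian in such a frame,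
  acts on \<open>\<phi>\<close> through its complex trace alone; the auxiliary connection, being that trace, cancels it.
  The curvature of the auxiliary connection is therefore the complex trace of R(X,Y), that is,
  \<open>\<Theta>(X,Y) = 1/2 tr (J R(X,Y))\<close>, whereas the same relation on \<open>\<phi>\<close> gives \<open>\<eta>(X,Y) = \<langle>JX,Y\<rangle>\<close>
  and hence \<open>(R \<bullet> \<eta>)(X,Y) = - 1/2 tr (J R(X,Y))\<close>. By the Bianchi identity
  \<open>tr (J R(X,Y)) = Ric(Y,JX) - Ric(X,JY)\<close>, which is a multiple of \<open>\<langle>JX,Y\<rangle>\<close> in the Einstein case.
\<close>

section \<open>Directional derivatives\<close>

text \<open>Smoothness is phrased through iterated directional derivatives, so the symmetry of
  second derivatives is first obtained from the mean value theorem; it makes the curvature tensorial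
  in the differentiated field and skew for the metric. The factor 1/2 comes from comparing two
  traces: a skew-Hermitian B with complex trace \<open>\<i> t\<close> has real trace
  \<open>-2 t\<close> after composition with J. Passing from the connection form to its curvature
  would in general produce quadratic terms; here they vanish because the trace of a commutator is
  zero, which is why the auxiliary curvature is a trace of R alone. In the Einstein case Ric = lam g
  gives R = 2n lam, and the two Ricci terms add up to 2 lam times the fundamental form, so that the
  1/2 leaves R/2n. Since the form of a spinor is quadratic in the spinor, this constant is absorbed
  by rescaling with its square root, a sign being left to E when R is negative.\<close>

abbreviation dderiv ::
  "('e::euclidean_space \<Rightarrow> 'f::real_normed_vector) \<Rightarrow> 'e \<Rightarrow> 'e \<Rightarrow> 'f" where
  "dderiv f X x \<equiv> frechet_derivative f (at x) X"

text \<open>\<open>frechet_derivative\<close> chooses some derivative. Functions with the same germ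
  have the same candidates, hence the same choice, even where neither is differentiable.\<close>

lemma frechet_derivative_cong_open:
  assumes "open S" "x \<in> S" "\<And>y. y \<in> S \<Longrightarrow> f y = h y"
  shows "frechet_derivative f (at x) = frechet_derivative h (at x)"
proof -
  have "(f has_derivative F) (at x) \<longleftrightarrow> (h has_derivative F) (at x)" for F
    by (metis assms has_derivative_transform_within_open)
  then show ?thesis by (simp add: frechet_derivative_def)
qed

lemma smooth_on_differentiable:
  assumes "smooth_on f S" "x \<in> S"
  shows "f differentiable (at x)"
  using assms Ck_on.simps(2)[of 0 f S] unfolding smooth_on_def by blast

lemma smooth_on_dderiv: "smooth_on f S \<Longrightarrow> smooth_on (dderiv f X) S"
  unfolding smooth_on_def by (metis Ck_on.simps(2))

lemma smooth_on_continuous: "smooth_on f S \<Longrightarrow> continuous_on S f"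
  unfolding smooth_on_def by (metis Ck_on.simps(1))

lemma smooth_on_const: "smooth_on (\<lambda>_. v) S"
proof -
  have "Ck_on k (\<lambda>_. v) S" for k
    by (induction k arbitrary: v) auto
  then show ?thesis by (simp add: smooth_on_def)
qed

lemma smooth_on_subset:
  assumes "smooth_on f S" "T \<subseteq> S"
  shows "smooth_on f T"
proof -
  have "Ck_on k f S \<Longrightarrow> Ck_on k f T" for k
    using assms(2)
  proof (induction k arbitrary: f)
    case 0
    then show ?case using continuous_on_subset by auto
  next
    case (Suc k)
    then show ?case by auto
  qed
  then show ?thesis using assms(1) by (auto simp: smooth_on_def)
qed

lemma dderiv_bounded_linear:
  assumes "f differentiable (at x)" "bounded_linear L"
  shows "dderiv (\<lambda>y. L (f y)) X x = L (dderiv f X x)"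
proof -
  have "(f has_derivative frechet_derivative f (at x)) (at x)"
    using assms(1) frechet_derivative_works by blast
  from frechet_derivative_at[OF bounded_linear.has_derivative[OF assms(2) this]]
  show ?thesis by (metis)
qed

lemma frechet_derivative_add:
  assumes "f differentiable (at x)" "h differentiable (at x)"
  shows "frechet_derivative (\<lambda>y. f y + h y) (at x) = (\<lambda>X. dderiv f X x + dderiv h X x)"
proof -
  have "((\<lambda>y. f y + h y) has_derivative (\<lambda>X. dderiv f X x + dderiv h X x)) (at x)"
    by (rule has_derivative_add) (use assms frechet_derivative_works in blast)+
  then show ?thesis by (rule frechet_derivative_at[symmetric])
qed

lemma frechet_derivative_sum:
  assumes "\<And>i. i \<in> I \<Longrightarrow> f i differentiable (at x)"
  shows "frechet_derivative (\<lambda>y. \<Sum>i\<in>I. f i y) (at x) = (\<lambda>X. \<Sum>i\<in>I. dderiv (f i) X x)"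
proof -
  have "((\<lambda>y. \<Sum>i\<in>I. f i y) has_derivative (\<lambda>X. \<Sum>i\<in>I. dderiv (f i) X x)) (at x)"
    by (rule has_derivative_sum) (use assms frechet_derivative_works in blast)
  then show ?thesis by (rule frechet_derivative_at[symmetric])
qed

section \<open>Symmetry of second directional derivatives\<close>

lemma line_derivative:
  assumes "f differentiable (at (a + s *\<^sub>R X))"
  shows "((\<lambda>s. f (a + s *\<^sub>R X)) has_vector_derivative dderiv f X (a + s *\<^sub>R X)) (at s)"
proof -
  have f: "(f has_derivative frechet_derivative f (at (a + s *\<^sub>R X))) (at (a + s *\<^sub>R X))"
    using assms frechet_derivative_works by blast
  have "((\<lambda>s. a + s *\<^sub>R X) has_derivative (\<lambda>h. h *\<^sub>R X)) (at s)"
    by (auto intro!: derivative_eq_intros)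
  from has_derivative_compose[OF this f] show ?thesis
    unfolding has_vector_derivative_def
    using linear_cmul[OF linear_frechet_derivative[OF assms]] by auto
qed

text \<open>The mean value theorem is applied twice: along X to the difference of f on two parallel
  segments, then along Y to the derivative of f in direction X. The second difference is symmetric
  in X and Y, so exchanging them yields the other mixed derivative at a nearby point.\<close>

lemma second_difference_mean_value:
  fixes f :: "'e::euclidean_space \<Rightarrow> real"
  assumes f: "\<And>y. y \<in> ball x r \<Longrightarrow> f differentiable (at y)"
    and Xf: "\<And>y. y \<in> ball x r \<Longrightarrow> dderiv f X differentiable (at y)"
    and t: "0 < t" "t * (norm X + norm Y) < r"
  shows "\<exists>z\<in>ball x r. f (x + t *\<^sub>R X + t *\<^sub>R Y) - f (x + t *\<^sub>R X) - f (x + t *\<^sub>R Y) + f x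
    = t * t * dderiv (dderiv f X) Y z"
proof -
  have mem: "x + a *\<^sub>R X + b *\<^sub>R Y \<in> ball x r" if "0 \<le> a" "a \<le> t" "0 \<le> b" "b \<le> t" for a b
  proof -
    have "norm (a *\<^sub>R X + b *\<^sub>R Y) \<le> a * norm X + b * norm Y"
      using norm_triangle_ineq[of "a *\<^sub>R X" "b *\<^sub>R Y"] that by simp
    also have "\<dots> \<le> t * norm X + t * norm Y"
      using that by (intro add_mono mult_right_mono) auto
    finally show ?thesis using t by (simp add: dist_norm norm_minus_commute algebra_simps)
  qed
  let ?h = "\<lambda>s. f (x + t *\<^sub>R Y + s *\<^sub>R X) - f (x + s *\<^sub>R X)"
  have d: "(?h has_real_derivative
      (dderiv f X (x + t *\<^sub>R Y + s *\<^sub>R X) - dderiv f X (x + s *\<^sub>R X))) (at s)"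
    if "0 \<le> s" "s \<le> t" for s
  proof -
    have "f differentiable (at (x + t *\<^sub>R Y + s *\<^sub>R X))" "f differentiable (at (x + s *\<^sub>R X))"
      using f mem[of s t] mem[of s 0] that t by (auto simp: algebra_simps)
    then show ?thesis
      unfolding has_real_derivative_iff_has_vector_derivative
      by (intro has_vector_derivative_diff line_derivative)
  qed
  obtain s where s: "0 < s" "s < t"
    "?h t - ?h 0 = (t - 0) * (dderiv f X (x + t *\<^sub>R Y + s *\<^sub>R X) - dderiv f X (x + s *\<^sub>R X))"
    using MVT2[OF t(1) d] by blast
  let ?k = "\<lambda>r. dderiv f X (x + s *\<^sub>R X + r *\<^sub>R Y)"
  have "(?k has_real_derivative dderiv (dderiv f X) Y (x + s *\<^sub>R X + q *\<^sub>R Y)) (at q)"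
    if "0 \<le> q" "q \<le> t" for q
    unfolding has_real_derivative_iff_has_vector_derivative
    using Xf mem[of s q] that s by (intro line_derivative) auto
  from MVT2[OF t(1) this] obtain q where q: "0 < q" "q < t"
    "?k t - ?k 0 = (t - 0) * dderiv (dderiv f X) Y (x + s *\<^sub>R X + q *\<^sub>R Y)" by blast
  have "f (x + t *\<^sub>R X + t *\<^sub>R Y) - f (x + t *\<^sub>R X) - f (x + t *\<^sub>R Y) + f x = ?h t - ?h 0"
    by (simp add: algebra_simps)
  also have "\<dots> = t * (?k t - ?k 0)"
    using s(3) by (simp add: algebra_simps)
  also have "\<dots> = t * t * dderiv (dderiv f X) Y (x + s *\<^sub>R X + q *\<^sub>R Y)"
    using q(3) by simp
  finally show ?thesis using mem[of s q] s q by (intro bexI) auto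
qed

text \<open>Both mixed derivatives take one common value arbitrarily close to x, though at different
  points z and w. By continuity each is within half of the supposed gap of its value at x, which is
  a contradiction.\<close>

lemma dderiv_commute_real:
  fixes f :: "'e::euclidean_space \<Rightarrow> real"
  assumes S: "open S" "x \<in> S" and f: "smooth_on f S"
  shows "dderiv (dderiv f X) Y x = dderiv (dderiv f Y) X x"
proof (rule ccontr)
  let ?A = "dderiv (dderiv f X) Y" and ?B = "dderiv (dderiv f Y) X"
  assume ne: "?A x \<noteq> ?B x"
  define \<epsilon> where "\<epsilon> = \<bar>?A x - ?B x\<bar> / 2"
  have \<epsilon>: "\<epsilon> > 0" using ne by (simp add: \<epsilon>_def)
  have cont: "isCont ?A x" "isCont ?B x"
    using smooth_on_continuous[OF smooth_on_dderiv[OF smooth_on_dderiv[OF f]]]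
      continuous_on_eq_continuous_at[OF S(1)] S(2) by metis+
  obtain r1 where r1: "r1 > 0" "\<And>z. dist z x < r1 \<Longrightarrow> dist (?A z) (?A x) < \<epsilon>"
    using cont(1) \<epsilon> unfolding continuous_at_eps_delta by blast
  obtain r2 where r2: "r2 > 0" "\<And>z. dist z x < r2 \<Longrightarrow> dist (?B z) (?B x) < \<epsilon>"
    using cont(2) \<epsilon> unfolding continuous_at_eps_delta by blast
  obtain r0 where r0: "r0 > 0" "ball x r0 \<subseteq> S" using S openE by blast
  define r where "r = min r0 (min r1 r2)"
  have r: "r > 0" using r0 r1 r2 by (simp add: r_def)
  have sub: "ball x r \<subseteq> S" using r0 by (auto simp: r_def)
  \<comment> \<open>Small enough that the parallelogram spanned by t X and t Y stays in the ball;
    the summand 1 keeps the denominator positive when X and Y vanish.\<close>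
  define t where "t = r / (2 * (norm X + norm Y + 1))"
  have pos: "norm X + norm Y + 1 > 0" by (smt (verit) norm_ge_zero)
  have t: "0 < t" using r pos by (simp add: t_def)
  have "t * (norm X + norm Y) \<le> t * (norm X + norm Y + 1)"
    using t by (simp add: algebra_simps)
  also have "\<dots> = r / 2" using pos unfolding t_def by (simp add: field_simps)
  also have "\<dots> < r" using r by simp
  finally have tr: "t * (norm X + norm Y) < r" .
  have D: "f differentiable (at y)" "dderiv f Z differentiable (at y)" if "y \<in> ball x r" for y Z
    using sub that by (auto intro!: smooth_on_differentiable[OF f]
        smooth_on_differentiable[OF smooth_on_dderiv[OF f]])
  obtain z where z: "z \<in> ball x r" "f (x + t *\<^sub>R X + t *\<^sub>R Y) - f (x + t *\<^sub>R X) - f (x + t *\<^sub>R Y) + f x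
    = t * t * ?A z"
    using second_difference_mean_value[OF D t tr] by metis
  have tr': "t * (norm Y + norm X) < r" using tr by (simp add: add.commute)
  obtain w where w: "w \<in> ball x r" "f (x + t *\<^sub>R Y + t *\<^sub>R X) - f (x + t *\<^sub>R Y) - f (x + t *\<^sub>R X) + f x
    = t * t * ?B w"
    using second_difference_mean_value[OF D t tr'] by metis
  have e: "x + t *\<^sub>R Y + t *\<^sub>R X = x + t *\<^sub>R X + t *\<^sub>R Y" by (simp add: algebra_simps)
  have "t * t * ?A z = t * t * ?B w" using z(2) w(2) unfolding e by linarith
  then have "?A z = ?B w" using t by simp
  moreover have "dist (?A z) (?A x) < \<epsilon>" "dist (?B w) (?B x) < \<epsilon>"
    using z(1) w(1) by (auto intro!: r1(2) r2(2) simp: r_def dist_commute[of x])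
  ultimately show False unfolding \<epsilon>_def dist_real_def by argo
qed

lemma Ck_on_cong:
  assumes "open S" "Ck_on k q S" "\<And>x. x \<in> S \<Longrightarrow> p x = q x"
  shows "Ck_on k p S"
  using assms(2,3)
proof (induction k arbitrary: p q)
  case 0
  then show ?case by (simp cong: continuous_on_cong)
next
  case (Suc k)
  have fd: "frechet_derivative p (at x) = frechet_derivative q (at x)" if "x \<in> S" for x
    by (rule frechet_derivative_cong_open[OF assms(1) that Suc.prems(2)])
  have "Ck_on k (dderiv p v) S" for v
    by (rule Suc.IH[of "dderiv q v"]) (use Suc.prems(1) fd in auto)
  moreover have "p differentiable (at x)" if "x \<in> S" for x
  proof -
    have "q differentiable (at x)" using Suc.prems(1) that by simp
    then obtain F where "(q has_derivative F) (at x)"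
      unfolding differentiable_def ..
    then have "(p has_derivative F) (at x)"
      by (rule has_derivative_transform_within_open[OF _ assms(1) that]) (simp add: Suc.prems(2))
    then show ?thesis by (auto simp: differentiable_def)
  qed
  ultimately show ?case by simp
qed

lemma smooth_on_inner:
  assumes "open S" "smooth_on f S"
  shows "smooth_on (\<lambda>x. f x \<bullet> b) S"
proof -
  have "Ck_on k (\<lambda>x. f x \<bullet> b) S" if "Ck_on k f S" for k
    using that
  proof (induction k arbitrary: f)
    case 0
    then show ?case by (auto intro: continuous_intros)
  next
    case (Suc k)
    have eq: "dderiv (\<lambda>x. f x \<bullet> b) v x = dderiv f v x \<bullet> b" if "x \<in> S" for v x
      using Suc.prems that by (intro dderiv_bounded_linear) (auto intro: bounded_linear_inner_left)
    have "Ck_on k (\<lambda>x. dderiv (\<lambda>x. f x \<bullet> b) v x) S" for v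
      by (rule Ck_on_cong[OF assms(1) Suc.IH[of "dderiv f v"]]) (use Suc.prems eq in auto)
    then show ?case using Suc.prems by (auto intro: differentiable_inner)
  qed
  then show ?thesis using assms(2) by (simp add: smooth_on_def)
qed

lemma dderiv_commute:
  fixes f :: "'e::euclidean_space \<Rightarrow> 'f::euclidean_space"
  assumes S: "open S" "x \<in> S" and f: "smooth_on f S"
  shows "dderiv (dderiv f X) Y x = dderiv (dderiv f Y) X x"
proof (rule euclidean_eqI)
  fix b :: 'f
  have *: "dderiv (dderiv (\<lambda>y. f y \<bullet> b) Z) W x = dderiv (dderiv f Z) W x \<bullet> b" for Z W
  proof -
    have "dderiv (\<lambda>y. f y \<bullet> b) Z y = dderiv f Z y \<bullet> b" if "y \<in> S" for y
      by (rule dderiv_bounded_linear[OF smooth_on_differentiable[OF f that] bounded_linear_inner_left])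
    then have "frechet_derivative (dderiv (\<lambda>y. f y \<bullet> b) Z) (at x)
        = frechet_derivative (\<lambda>y. dderiv f Z y \<bullet> b) (at x)"
      by (rule frechet_derivative_cong_open[OF S])
    then have "dderiv (dderiv (\<lambda>y. f y \<bullet> b) Z) W x = dderiv (\<lambda>y. dderiv f Z y \<bullet> b) W x"
      by (simp only:)
    also have "\<dots> = dderiv (dderiv f Z) W x \<bullet> b"
      by (rule dderiv_bounded_linear[OF smooth_on_differentiable[OF smooth_on_dderiv[OF f] S(2)]
            bounded_linear_inner_left])
    finally show ?thesis .
  qed
  show "dderiv (dderiv f X) Y x \<bullet> b = dderiv (dderiv f Y) X x \<bullet> b"
    by (rule dderiv_commute_real[OF S smooth_on_inner[OF S(1) f, of b], of X Y, unfolded *])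
qed

text \<open>Product rule when only the maps \<open>\<lambda>y. A y v\<close> with fixed v are known
  to be differentiable, which is how smoothness of tensor fields is stated. Expanding f in the basis
  turns \<open>A y (f y)\<close> into a finite sum of products of a scalar and a vector
  function.\<close>

lemma has_derivative_linear_apply:
  fixes f :: "'e::euclidean_space \<Rightarrow> 'f::euclidean_space"
    and A :: "'e \<Rightarrow> 'f \<Rightarrow> 'h::real_normed_vector"
  assumes S: "open S" "x \<in> S" and lin: "\<And>y. y \<in> S \<Longrightarrow> linear (A y)"
    and A: "\<And>v. (\<lambda>y. A y v) differentiable (at x)" and f: "f differentiable (at x)"
  shows "((\<lambda>y. A y (f y)) has_derivative
    (\<lambda>X. dderiv (\<lambda>y. A y (f x)) X x + A x (dderiv f X x))) (at x)"
proof -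
  have expand: "A y v = (\<Sum>b\<in>Basis. (v \<bullet> b) *\<^sub>R A y b)" if "y \<in> S" for y v
  proof -
    interpret linear "A y" by (rule lin[OF that])
    show ?thesis
      using euclidean_representation[of v] by (metis (no_types, lifting) scaleR sum sum.cong)
  qed
  have Ad: "((\<lambda>y. A y v) has_derivative frechet_derivative (\<lambda>y. A y v) (at x)) (at x)" for v
    using A frechet_derivative_works by blast
  have fd: "(f has_derivative frechet_derivative f (at x)) (at x)"
    using f frechet_derivative_works by blast
  have "((\<lambda>y. \<Sum>b\<in>Basis. (f x \<bullet> b) *\<^sub>R A y b) has_derivative
      (\<lambda>X. \<Sum>b\<in>Basis. (f x \<bullet> b) *\<^sub>R dderiv (\<lambda>y. A y b) X x)) (at x)"
    by (intro has_derivative_sum has_derivative_scaleR_right Ad)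
  then have A0: "((\<lambda>y. A y (f x)) has_derivative
      (\<lambda>X. \<Sum>b\<in>Basis. (f x \<bullet> b) *\<^sub>R dderiv (\<lambda>y. A y b) X x)) (at x)"
    by (rule has_derivative_transform_within_open[OF _ S]) (rule expand[symmetric])
  have A1: "dderiv (\<lambda>y. A y (f x)) X x = (\<Sum>b\<in>Basis. (f x \<bullet> b) *\<^sub>R dderiv (\<lambda>y. A y b) X x)" for X
    by (simp only: frechet_derivative_at[OF A0, symmetric])
  have "((\<lambda>y. \<Sum>b\<in>Basis. (f y \<bullet> b) *\<^sub>R A y b) has_derivative
      (\<lambda>X. \<Sum>b\<in>Basis. (f x \<bullet> b) *\<^sub>R dderiv (\<lambda>y. A y b) X x + (dderiv f X x \<bullet> b) *\<^sub>R A x b)) (at x)"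
    by (intro has_derivative_sum has_derivative_scaleR Ad has_derivative_inner_left fd)
  then have "((\<lambda>y. A y (f y)) has_derivative
      (\<lambda>X. \<Sum>b\<in>Basis. (f x \<bullet> b) *\<^sub>R dderiv (\<lambda>y. A y b) X x + (dderiv f X x \<bullet> b) *\<^sub>R A x b)) (at x)"
    by (rule has_derivative_transform_within_open[OF _ S]) (rule expand[symmetric])
  moreover have "(\<Sum>b\<in>Basis. (f x \<bullet> b) *\<^sub>R dderiv (\<lambda>y. A y b) X x + (dderiv f X x \<bullet> b) *\<^sub>R A x b)
      = dderiv (\<lambda>y. A y (f x)) X x + A x (dderiv f X x)" for X
    by (simp only: sum.distrib A1 expand[OF S(2), of "dderiv f X x"])
  ultimately show ?thesis by (simp only:)
qed

lemma has_derivative_bilinear_apply: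
  fixes f :: "'e::euclidean_space \<Rightarrow> 'f::euclidean_space" and h :: "'e \<Rightarrow> 'f2::euclidean_space"
    and B :: "'e \<Rightarrow> 'f \<Rightarrow> 'f2 \<Rightarrow> 'h::real_normed_vector"
  assumes S: "open S" "x \<in> S" and bil: "\<And>y. y \<in> S \<Longrightarrow> bilinear (B y)"
    and B: "\<And>v w. (\<lambda>y. B y v w) differentiable (at x)"
    and f: "f differentiable (at x)" and h: "h differentiable (at x)"
  shows "((\<lambda>y. B y (f y) (h y)) has_derivative
    (\<lambda>X. dderiv (\<lambda>y. B y (f x) (h x)) X x + B x (f x) (dderiv h X x) + B x (dderiv f X x) (h x)))
    (at x)"
proof -
  have 1: "((\<lambda>y. B y v (h y)) has_derivative
      (\<lambda>X. dderiv (\<lambda>y. B y v (h x)) X x + B x v (dderiv h X x))) (at x)" for v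
    by (rule has_derivative_linear_apply[OF S _ B h]) (use bil in \<open>simp add: bilinear_def\<close>)
  have 2: "((\<lambda>y. B y (f y) (h y)) has_derivative
      (\<lambda>X. dderiv (\<lambda>y. B y (f x) (h y)) X x + B x (dderiv f X x) (h x))) (at x)"
  proof (rule has_derivative_linear_apply[OF S, where A = "\<lambda>y v. B y v (h y)"])
    show "linear (\<lambda>v. B y v (h y))" if "y \<in> S" for y
      using bil[OF that] by (simp add: bilinear_def)
    show "(\<lambda>y. B y v (h y)) differentiable (at x)" for v
      by (rule differentiableI[OF 1])
  qed (rule f)
  have "dderiv (\<lambda>y. B y (f x) (h y)) X x
      = dderiv (\<lambda>y. B y (f x) (h x)) X x + B x (f x) (dderiv h X x)" for X
    by (simp only: frechet_derivative_at[OF 1[of "f x"], symmetric])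
  with 2 show ?thesis by (simp only:)
qed

section \<open>Spinor algebra\<close>

text \<open>The mixed product rule of Kronecker products: distributivity turns a sum over all sign
  patterns into a slotwise product of 2 by 2 matrices.\<close>

lemma sum_prod_matrix_mult:
  fixes P Q :: "'n::finite \<Rightarrow> bool \<Rightarrow> bool \<Rightarrow> complex"
  shows "(\<Sum>\<beta>\<in>UNIV. (\<Prod>k\<in>UNIV. P k (\<alpha> k) (\<beta> k)) * (\<Prod>k\<in>UNIV. Q k (\<beta> k) (\<gamma> k)))
    = (\<Prod>k\<in>UNIV. \<Sum>b\<in>UNIV. P k (\<alpha> k) b * Q k b (\<gamma> k))"
proof -
  have "(\<Prod>k\<in>UNIV. \<Sum>b\<in>UNIV. P k (\<alpha> k) b * Q k b (\<gamma> k))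
      = (\<Sum>\<beta>\<in>PiE UNIV (\<lambda>_. UNIV). \<Prod>k\<in>UNIV. P k (\<alpha> k) (\<beta> k) * Q k (\<beta> k) (\<gamma> k))"
    by (rule prod_sum_PiE) auto
  then show ?thesis by (simp add: PiE_UNIV_domain prod.distrib)
qed

text \<open>The tensor factor in slot k of the generator a, isolated so that the Clifford relations
  can be checked slot by slot.\<close>

definition genfac :: "'n::linorder \<times> bool \<Rightarrow> 'n \<Rightarrow> bool \<Rightarrow> bool \<Rightarrow> complex" where
  "genfac a k = (if k = fst a then gmat (snd a) else if k < fst a then tmat else idmat)"

lemma clifford_gen_nth: "clifford_gen a $ \<alpha> $ \<beta> = (\<Prod>k\<in>UNIV. genfac a k (\<alpha> k) (\<beta> k))"
  by (simp add: clifford_gen_def genfac_def)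

lemma clifford_gen_mult_nth:
  "(clifford_gen a ** clifford_gen b) $ \<alpha> $ \<gamma>
    = (\<Prod>k\<in>UNIV. \<Sum>t\<in>UNIV. genfac a k (\<alpha> k) t * genfac b k t (\<gamma> k))"
  by (simp add: matrix_matrix_mult_def clifford_gen_nth sum_prod_matrix_mult)

lemma clifford_gen_square: "clifford_gen a ** clifford_gen a = - mat 1"
proof -
  have fac: "(\<Sum>t\<in>UNIV. genfac a k p t * genfac a k t q)
      = (if k = fst a then -1 else 1) * (if p = q then 1 else 0)" for k p q
    by (auto simp: genfac_def gmat_def tmat_def idmat_def UNIV_bool)
  have "(clifford_gen a ** clifford_gen a) $ \<alpha> $ \<gamma> = (- mat 1) $ \<alpha> $ \<gamma>" for \<alpha> \<gamma>
  proof -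
    have "(\<Prod>k\<in>UNIV. (if k = fst a then -1 else 1 :: complex)) = -1"
      by (simp add: prod.delta)
    moreover have "(\<Prod>k\<in>UNIV. (if \<alpha> k = \<gamma> k then 1 else 0 :: complex)) = (if \<alpha> = \<gamma> then 1 else 0)"
      by (auto simp: prod_zero_iff)
    ultimately show ?thesis
      unfolding clifford_gen_mult_nth fac prod.distrib by (simp add: mat_def)
  qed
  then show ?thesis by (simp add: vec_eq_iff)
qed

text \<open>The factors anticommute in exactly one slot, the smaller of the two positions: there
  either g_1 meets g_2, or a g meets T. In all other slots at least one factor is the identity or
  both are T.\<close>

lemma clifford_gen_anticommute:
  assumes "a \<noteq> b"
  shows "clifford_gen a ** clifford_gen b = - (clifford_gen b ** clifford_gen a)"
proof -
  define m where "m = min (fst a) (fst b)"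
  have fac: "(\<Sum>t\<in>UNIV. genfac a k p t * genfac b k t q)
      = (if k = m then -1 else 1) * (\<Sum>t\<in>UNIV. genfac b k p t * genfac a k t q)" for k p q
    using assms
    by (cases a; cases b)
      (auto simp: genfac_def gmat_def tmat_def idmat_def UNIV_bool m_def min_def)
  have "(\<Prod>k\<in>UNIV. (if k = m then -1 else 1 :: complex)) = -1"
    by (simp add: prod.delta)
  then have "(clifford_gen a ** clifford_gen b) $ \<alpha> $ \<gamma>
      = (- (clifford_gen b ** clifford_gen a)) $ \<alpha> $ \<gamma>" for \<alpha> \<gamma>
    unfolding clifford_gen_mult_nth fac prod.distrib
    by (simp add: clifford_gen_mult_nth)
  then show ?thesis by (simp add: vec_eq_iff)
qed

text \<open>g_1 and g_2 are skew-Hermitian while T and the identity are Hermitian, so exactly one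
  slot contributes a sign.\<close>

lemma clifford_gen_skew: "cnj (clifford_gen a $ \<beta> $ \<alpha>) = - clifford_gen a $ \<alpha> $ \<beta>"
proof -
  have fac: "cnj (genfac a k p q) = (if k = fst a then -1 else 1) * genfac a k q p" for k p q
    by (auto simp: genfac_def gmat_def tmat_def idmat_def)
  have "(\<Prod>k\<in>UNIV. (if k = fst a then -1 else 1 :: complex)) = -1"
    by (simp add: prod.delta)
  then show ?thesis
    unfolding clifford_gen_nth cnj_prod fac prod.distrib by simp
qed

lemma smult_scaleR_commute: "c *s (r *\<^sub>R v) = r *\<^sub>R (c *s v)" for v :: "complex ^ 'm"
  by (simp add: vec_eq_iff)

text \<open>In slot j, g_2 u_{-1} = - u_{+1} = i g_1 u_{-1}; in every other slot the two generators
  have the same factor.\<close>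

lemma clifford_gen_vacuum:
  "clifford_gen (j, True) $ \<alpha> $ (\<lambda>_. False) = \<i> * clifford_gen (j, False) $ \<alpha> $ (\<lambda>_. False)"
proof -
  have fac: "genfac (j, True) k p False = (if k = j then \<i> else 1) * genfac (j, False) k p False" for k p
    by (auto simp: genfac_def gmat_def)
  have "(\<Prod>k\<in>UNIV. (if k = j then \<i> else 1)) = \<i>"
    by (simp add: prod.delta)
  then show ?thesis unfolding clifford_gen_nth fac prod.distrib by simp
qed

text \<open>Replaces sums over ordered pairs by full double sums, on which expansions in an
  orthonormal basis can be used.\<close>

lemma sum_idx_less:
  fixes F :: "'n::{finite, linorder} \<times> bool \<Rightarrow> 'n \<times> bool \<Rightarrow> 'b::real_vector"
  assumes sym: "\<And>a b. F b a = F a b" and diag: "\<And>a. F a a = 0"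
  shows "2 *\<^sub>R (\<Sum>(a, b)\<in>{(a, b). idx_less a b}. F a b) = (\<Sum>a\<in>UNIV. \<Sum>b\<in>UNIV. F a b)"
proof -
  let ?L = "{(a, b). idx_less a b} :: (('n \<times> bool) \<times> ('n \<times> bool)) set"
  let ?G = "{(a, b). idx_less b a} :: (('n \<times> bool) \<times> ('n \<times> bool)) set"
  let ?F = "\<lambda>(a, b). F a b"
  have U: "UNIV = ?L \<union> (?G \<union> Id)"
  proof -
    have "idx_less a b \<or> idx_less b a \<or> a = b" for a b :: "'n \<times> bool"
      by (cases a; cases b) (auto simp: idx_less_def)
    then show ?thesis by auto
  qed
  have "sum ?F ?G = sum ?F ?L"
    by (rule sum.reindex_bij_witness[of _ prod.swap prod.swap]) (auto simp: sym)
  moreover have "sum ?F Id = 0"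
    by (rule sum.neutral) (auto simp: diag)
  moreover have "sum ?F (?L \<union> (?G \<union> Id)) = sum ?F ?L + sum ?F (?G \<union> Id)"
    by (rule sum.union_disjoint) (auto simp: idx_less_def)
  moreover have "sum ?F (?G \<union> Id) = sum ?F ?G + sum ?F Id"
    by (rule sum.union_disjoint) (auto simp: idx_less_def)
  ultimately have "sum ?F UNIV = 2 *\<^sub>R sum ?F ?L"
    by (simp add: U[symmetric] scaleR_2)
  then show ?thesis by (simp add: sum.cartesian_product)
qed

section \<open>Clifford multiplication by vectors and its relations\<close>

lemma bilinear_cliff: "bilinear cliff"
  unfolding bilinear_def
  by (auto intro!: linearI simp: cliff_def vec_eq_iff inner_add_left algebra_simps
      sum.distrib scaleR_sum_right sum_distrib_left sum_distrib_right)

lemmas cliff_add_left = bilinear_ladd[OF bilinear_cliff]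
  and cliff_add_right = bilinear_radd[OF bilinear_cliff]
  and cliff_scaleR_left = bilinear_lmul[OF bilinear_cliff]
  and cliff_scaleR_right = bilinear_rmul[OF bilinear_cliff]
  and cliff_minus_left = bilinear_lneg[OF bilinear_cliff]
  and cliff_zero_right = bilinear_rzero[OF bilinear_cliff]

lemma cliff_smult: "cliff x (c *s \<psi>) = c *s cliff x \<psi>"
  by (simp add: cliff_def vec_eq_iff sum_distrib_left algebra_simps)

lemma ebas_inner: "ebas a \<bullet> ebas b = (if a = b then 1 else 0)"
  by (cases a; cases b) (auto simp: ebas_def inner_axis_axis)

lemma Basis_eq_ebas: "Basis = range (ebas :: 'n::finite \<times> bool \<Rightarrow> 'n cvec)"
  unfolding Basis_vec_def Basis_complex_def ebas_def
  by (auto simp: image_iff split: if_splits) force+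

lemma inj_ebas: "inj ebas"
  by (rule injI) (metis ebas_inner zero_neq_one)

lemma sum_Basis_ebas: "(\<Sum>b\<in>Basis. f b) = (\<Sum>a\<in>UNIV. f (ebas a))"
  unfolding Basis_eq_ebas by (simp add: sum.reindex inj_ebas)

lemma ebas_expansion: "(\<Sum>a\<in>UNIV. (x \<bullet> ebas a) *\<^sub>R ebas a) = x"
  using euclidean_representation[of x] by (simp add: sum_Basis_ebas)

lemma sum_index: "(\<Sum>a\<in>UNIV. f a) = (\<Sum>j\<in>UNIV. f (j, False) + f (j, True))"
  for f :: "'n::finite \<times> bool \<Rightarrow> 'b::comm_monoid_add"
proof -
  have "(\<Sum>a\<in>UNIV. f a) = (\<Sum>a\<in>UNIV \<times> UNIV. f a)" by simp
  also have "\<dots> = (\<Sum>j\<in>UNIV. \<Sum>s\<in>UNIV. f (j, s))"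
    using sum.cartesian_product[of "\<lambda>j s. f (j, s)" UNIV UNIV] by simp
  also have "\<dots> = (\<Sum>j\<in>UNIV. f (j, False) + f (j, True))"
    by (simp add: UNIV_bool)
  finally show ?thesis .
qed

lemma cliff_ebas_nth:
  "cliff (ebas a) \<psi> $ (\<alpha>, s) = (\<Sum>\<beta>\<in>UNIV. clifford_gen a $ \<alpha> $ \<beta> * \<psi> $ (\<beta>, s))"
proof -
  have "(\<Sum>c\<in>UNIV. (ebas a \<bullet> ebas c) *\<^sub>R clifford_gen c) = clifford_gen a"
    unfolding ebas_inner by (simp add: if_distrib[of "\<lambda>r. r *\<^sub>R _"] sum.delta cong: if_cong)
  then show ?thesis by (simp add: cliff_def)
qed

lemma cliff_cliff_ebas_nth:
  "cliff (ebas a) (cliff (ebas b) \<psi>) $ (\<alpha>, s)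
    = (\<Sum>\<beta>\<in>UNIV. (clifford_gen a ** clifford_gen b) $ \<alpha> $ \<beta> * \<psi> $ (\<beta>, s))"
  unfolding cliff_ebas_nth matrix_matrix_mult_def
  by (simp add: sum_distrib_left sum_distrib_right mult.assoc) (rule sum.swap)

lemma clifford_relation_ebas:
  "cliff (ebas a) (cliff (ebas b) \<psi>) + cliff (ebas b) (cliff (ebas a) \<psi>)
    = (-2 * (ebas a \<bullet> ebas b)) *\<^sub>R \<psi>"
proof -
  have "cliff (ebas a) (cliff (ebas b) \<psi>) $ (\<alpha>, s) + cliff (ebas b) (cliff (ebas a) \<psi>) $ (\<alpha>, s)
      = ((-2 * (ebas a \<bullet> ebas b)) *\<^sub>R \<psi>) $ (\<alpha>, s)" for \<alpha> s
  proof (cases "a = b")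
    case True
    have "(\<Sum>\<beta>\<in>UNIV. (- mat 1 :: complex^('a \<Rightarrow> bool)^('a \<Rightarrow> bool)) $ \<alpha> $ \<beta> * \<psi> $ (\<beta>, s)) = - \<psi> $ (\<alpha>, s)"
      by (simp add: mat_def if_distrib[of "\<lambda>r. r * _"] sum.delta sum_negf cong: if_cong)
    then show ?thesis
      using True by (simp add: cliff_cliff_ebas_nth clifford_gen_square ebas_inner scaleR_conv_of_real)
  next
    case False
    then show ?thesis
      by (simp add: cliff_cliff_ebas_nth clifford_gen_anticommute[OF False] ebas_inner sum_negf)
  qed
  then show ?thesis by (auto simp: vec_eq_iff)
qed

lemma linear_eq_ebas:
  fixes f h :: "'n::finite cvec \<Rightarrow> 'b::real_vector"
  assumes "linear f" "linear h" "\<And>a. f (ebas a) = h (ebas a)"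
  shows "f x = h x"
proof -
  have "x \<in> span (range ebas)" unfolding Basis_eq_ebas[symmetric] span_Basis by simp
  then show ?thesis by (rule linear_eq_on_span[OF assms(1,2), rotated]) (use assms(3) in auto)
qed

lemma bilinear_eq_ebas:
  fixes f h :: "'n::finite cvec \<Rightarrow> 'n cvec \<Rightarrow> 'b::real_vector"
  assumes "bilinear f" "bilinear h" "\<And>a b. f (ebas a) (ebas b) = h (ebas a) (ebas b)"
  shows "f x y = h x y"
proof -
  have "x \<in> span (range ebas)" "y \<in> span (range ebas)"
    unfolding Basis_eq_ebas[symmetric] span_Basis by simp_all
  then show ?thesis
    by (rule bilinear_eq[OF assms(1,2) subset_refl subset_refl]) (auto simp: assms(3))
qed

lemma clifford_relation:
  "cliff x (cliff y \<psi>) + cliff y (cliff x \<psi>) = (-2 * (x \<bullet> y)) *\<^sub>R \<psi>"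
proof (rule bilinear_eq_ebas[where f = "\<lambda>x y. cliff x (cliff y \<psi>) + cliff y (cliff x \<psi>)"
      and h = "\<lambda>x y. (-2 * (x \<bullet> y)) *\<^sub>R \<psi>"])
  show "bilinear (\<lambda>x y. cliff x (cliff y \<psi>) + cliff y (cliff x \<psi>))"
    unfolding bilinear_def
    by (auto intro!: linearI simp: cliff_add_left cliff_add_right cliff_scaleR_left
        cliff_scaleR_right algebra_simps)
  show "bilinear (\<lambda>x y. (-2 * (x \<bullet> y)) *\<^sub>R \<psi>)"
    unfolding bilinear_def by (auto intro!: linearI simp: inner_add_left inner_add_right algebra_simps)
qed (rule clifford_relation_ebas)

section \<open>The Hermitian product and the skewness of Clifford multiplication\<close>

lemma herm_add_left: "herm (\<psi> + \<psi>') \<xi> = herm \<psi> \<xi> + herm \<psi>' \<xi>"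
  by (simp add: herm_def algebra_simps sum.distrib)

lemma herm_add_right: "herm \<psi> (\<xi> + \<xi>') = herm \<psi> \<xi> + herm \<psi> \<xi>'"
  by (simp add: herm_def algebra_simps sum.distrib)

lemma herm_scaleR_left: "herm (r *\<^sub>R \<psi>) \<xi> = r *\<^sub>R herm \<psi> \<xi>"
  by (simp add: herm_def scaleR_sum_right)

lemma herm_scaleR_right: "herm \<psi> (r *\<^sub>R \<xi>) = r *\<^sub>R herm \<psi> \<xi>"
  by (simp add: herm_def scaleR_sum_right)

lemma herm_smult_left: "herm (c *s \<psi>) \<xi> = c * herm \<psi> \<xi>"
  by (simp add: herm_def sum_distrib_left algebra_simps)

lemma herm_commute: "herm \<xi> \<psi> = cnj (herm \<psi> \<xi>)"
  by (simp add: herm_def mult.commute)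

lemma herm_sum_pairs: "herm \<psi> \<xi> = (\<Sum>\<alpha>\<in>UNIV. \<Sum>s\<in>UNIV. \<psi> $ (\<alpha>, s) * cnj (\<xi> $ (\<alpha>, s)))"
  unfolding herm_def UNIV_Times_UNIV[symmetric] sum.cartesian_product by (simp add: case_prod_unfold)

lemma herm_cliff_ebas: "herm (cliff (ebas a) \<psi>) \<xi> = - herm \<psi> (cliff (ebas a) \<xi>)"
proof -
  have "herm (cliff (ebas a) \<psi>) \<xi> = (\<Sum>s\<in>UNIV. \<Sum>\<alpha>\<in>UNIV. \<Sum>\<beta>\<in>UNIV.
      clifford_gen a $ \<alpha> $ \<beta> * \<psi> $ (\<beta>, s) * cnj (\<xi> $ (\<alpha>, s)))"
    unfolding herm_sum_pairs cliff_ebas_nth sum_distrib_right by (rule sum.swap)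
  also have "\<dots> = (\<Sum>s\<in>UNIV. \<Sum>\<beta>\<in>UNIV. \<Sum>\<alpha>\<in>UNIV.
      clifford_gen a $ \<alpha> $ \<beta> * \<psi> $ (\<beta>, s) * cnj (\<xi> $ (\<alpha>, s)))"
    by (intro sum.cong refl sum.swap)
  also have "\<dots> = - (\<Sum>s\<in>UNIV. \<Sum>\<beta>\<in>UNIV. \<Sum>\<alpha>\<in>UNIV.
      \<psi> $ (\<beta>, s) * cnj (clifford_gen a $ \<beta> $ \<alpha> * \<xi> $ (\<alpha>, s)))"
    by (simp add: clifford_gen_skew sum_negf mult_ac)
  also have "\<dots> = - herm \<psi> (cliff (ebas a) \<xi>)"
    unfolding herm_sum_pairs cliff_ebas_nth cnj_sum sum_distrib_left
    by (subst sum.swap) (rule refl)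
  finally show ?thesis .
qed

lemma herm_cliff: "herm (cliff x \<psi>) \<xi> = - herm \<psi> (cliff x \<xi>)"
proof -
  have "linear (\<lambda>x. herm (cliff x \<psi>) \<xi>)" "linear (\<lambda>x. - herm \<psi> (cliff x \<xi>))"
    by (auto intro!: linearI simp: cliff_add_left cliff_scaleR_left herm_add_left herm_add_right
        herm_scaleR_left herm_scaleR_right)
  then show ?thesis by (rule linear_eq_ebas) (rule herm_cliff_ebas)
qed

section \<open>The model spinor and its purity\<close>

lemma model_spinor_nth: "model_spinor $ (\<beta>, s) = (if \<beta> = (\<lambda>_. False) \<and> s then 1 else 0)"
  by (auto simp: model_spinor_def axis_def)

lemma f12_model_spinor: "f12 model_spinor = \<i> *s model_spinor"
  by (auto simp: vec_eq_iff f12_def fcliff_def gmat_def model_spinor_nth UNIV_bool)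

lemma f12_scaleR: "f12 (r *\<^sub>R \<psi>) = r *\<^sub>R f12 \<psi>"
  by (simp add: vec_eq_iff f12_def fcliff_def UNIV_bool algebra_simps)

lemma herm_model_spinor: "herm model_spinor model_spinor = 1"
  unfolding herm_sum_pairs by (simp add: model_spinor_nth UNIV_bool if_distrib sum.delta cong: if_cong)

lemma cliff_ebas_model_nth:
  "cliff (ebas a) model_spinor $ (\<alpha>, s) = (if s then clifford_gen a $ \<alpha> $ (\<lambda>_. False) else 0)"
  unfolding cliff_ebas_nth model_spinor_nth
  by (simp add: if_distrib[of "\<lambda>r. _ * r"] sum.delta cong: if_cong)

text \<open>Purity of the spinor, the algebraic link between J and multiplication by i. Real
  linearity in x leaves the basis vectors: \<open>clifford_gen_vacuum\<close> treats the vectors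
  e_{2j-1}, and multiplying that relation by i treats e_{2j}.\<close>

lemma cliff_ii_model_spinor:
  fixes x :: "'n::{finite, linorder} cvec"
  shows "cliff (\<i> *s x) model_spinor = \<i> *s cliff x model_spinor"
proof -
  have "linear (\<lambda>x::'n cvec. cliff (\<i> *s x) model_spinor)" "linear (\<lambda>x::'n cvec. \<i> *s cliff x model_spinor)"
    by (auto intro!: linearI simp: cliff_add_left cliff_scaleR_left vector_add_ldistrib
        smult_scaleR_commute)
  moreover have "cliff (\<i> *s ebas a) model_spinor = \<i> *s cliff (ebas a) model_spinor" for a :: "'n \<times> bool"
  proof -
    obtain j s where a: "a = (j, s)" by fastforce
    have T: "cliff (ebas (j, True)) model_spinor = \<i> *s cliff (ebas (j, False)) model_spinor"
      by (auto simp: vec_eq_iff cliff_ebas_model_nth clifford_gen_vacuum)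
    have F: "\<i> *s ebas (j, False) = ebas (j, True)" "\<i> *s ebas (j, True) = (-1) *\<^sub>R ebas (j, False)"
      by (auto simp: ebas_def axis_def vec_eq_iff)
    show ?thesis
      by (cases s) (simp_all add: a F T cliff_scaleR_left del: scaleR_minus1_left, simp add: vec_eq_iff cliff_minus_left)
  qed
  ultimately show ?thesis by (rule linear_eq_ebas)
qed

lemma inner_ii_left: "(\<i> *s x) \<bullet> y = - (x \<bullet> (\<i> *s y))"
  for x y :: "'n::finite cvec"
  by (simp add: inner_vec_def inner_complex_def sum_negf[symmetric] algebra_simps)

text \<open>Since vectors act skew-Hermitianly, exchanging x and y conjugates the product, so the
  real part is symmetric. It is therefore half of what the Clifford relation gives for the
  sum.\<close>

lemma re_herm_cliff_model:
  "Re (herm (cliff x (cliff y model_spinor)) model_spinor) = - (x \<bullet> y)"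
proof -
  let ?h = "\<lambda>x y. herm (cliff x (cliff y model_spinor)) (model_spinor :: 'a twisted)"
  have "?h y x = cnj (?h x y)"
    using herm_cliff[of y "cliff x model_spinor" model_spinor]
      herm_cliff[of x "cliff y model_spinor" model_spinor]
      herm_commute[of "cliff x model_spinor" "cliff y model_spinor"] by simp
  then have "Re (?h y x) = Re (?h x y)" by simp
  moreover have "?h x y + ?h y x = of_real (-2 * (x \<bullet> y))"
    unfolding herm_add_left[symmetric] clifford_relation herm_scaleR_left herm_model_spinor
    by (simp add: scaleR_conv_of_real)
  then have "Re (?h x y) + Re (?h y x) = -2 * (x \<bullet> y)"
    by (metis Re_complex_of_real plus_complex.sel(1))
  ultimately have "Re (?h x y) + Re (?h x y) = -2 * (x \<bullet> y)"
    by simp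
  then show ?thesis by simp
qed

text \<open>\<open>f12\<close> acts on the spinor as i, and purity moves this i into the vector y.
  The correction term is then purely imaginary and disappears from the real part.\<close>

lemma re_herm_f12_model:
  "Re (herm (cliff x (cliff y (f12 model_spinor)) + (x \<bullet> y) *\<^sub>R f12 model_spinor) model_spinor)
    = (\<i> *s x) \<bullet> y"
proof -
  have "herm (cliff x (cliff y (f12 model_spinor)) + (x \<bullet> y) *\<^sub>R f12 model_spinor) model_spinor
      = herm (cliff x (cliff (\<i> *s y) model_spinor)) model_spinor + (x \<bullet> y) *\<^sub>R \<i>"
    by (simp add: herm_add_left herm_scaleR_left f12_model_spinor herm_smult_left herm_model_spinor
        cliff_smult cliff_ii_model_spinor)
  then show ?thesis by (simp add: re_herm_cliff_model inner_ii_left)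
qed

text \<open>
  As \<open>e\<^sub>2\<^sub>j \<phi> = \<i> e\<^sub>2\<^sub>j\<^sub>-\<^sub>1 \<phi>\<close> and B is complex linear, the sum reduces to terms
  \<open>(e\<^sub>2\<^sub>j\<^sub>-\<^sub>1 + \<i> e\<^sub>2\<^sub>j) w \<phi>\<close>, and \<open>e\<^sub>2\<^sub>j\<^sub>-\<^sub>1 + \<i> e\<^sub>2\<^sub>j\<close> annihilates \<open>\<phi>\<close>.
\<close>

lemma spin_action_model_spinor:
  fixes B :: "'n::{finite, linorder} cvec \<Rightarrow> 'n cvec"
  assumes skew: "\<And>v w. B v \<bullet> w = - (v \<bullet> B w)" and clin: "\<And>v. B (\<i> *s v) = \<i> *s B v"
  shows "(\<Sum>(a, b)\<in>{(a, b). idx_less a b}.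
      (B (ebas a) \<bullet> ebas b) *\<^sub>R cliff (ebas a) (cliff (ebas b) model_spinor))
    = (\<Sum>j\<in>UNIV. B (axis j 1) \<bullet> axis j \<i>) *\<^sub>R (- \<i> *s model_spinor)"
proof -
  let ?\<Phi> = "model_spinor :: 'n twisted"
  let ?F = "\<lambda>a b. (B (ebas a) \<bullet> ebas b) *\<^sub>R cliff (ebas a) (cliff (ebas b) ?\<Phi>)"
  have "(\<Sum>b\<in>UNIV. ?F a b) = cliff (ebas a) (cliff (B (ebas a)) ?\<Phi>)" for a
  proof -
    have lin: "linear (\<lambda>w. cliff (ebas a) (cliff w ?\<Phi>))"
      by (auto intro!: linearI simp: cliff_add_left cliff_add_right cliff_scaleR_left cliff_scaleR_right)
    have "(\<Sum>b\<in>UNIV. ?F a b)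
        = (\<lambda>w. cliff (ebas a) (cliff w ?\<Phi>)) (\<Sum>b\<in>UNIV. (B (ebas a) \<bullet> ebas b) *\<^sub>R ebas b)"
      by (simp only: linear_sum[OF lin] linear_cmul[OF lin])
    then show ?thesis by (simp only: ebas_expansion)
  qed
  moreover have "2 *\<^sub>R (\<Sum>(a, b)\<in>{(a, b). idx_less a b}. ?F a b) = (\<Sum>a\<in>UNIV. \<Sum>b\<in>UNIV. ?F a b)"
  proof (rule sum_idx_less)
    show "?F a a = 0" for a
      using skew[of "ebas a" "ebas a"] by (simp add: inner_commute)
    show "?F b a = ?F a b" for a b
    proof (cases "a = b")
      case False
      then have "cliff (ebas b) (cliff (ebas a) ?\<Phi>) = - cliff (ebas a) (cliff (ebas b) ?\<Phi>)"
        using clifford_relation_ebas[of b a ?\<Phi>] by (simp add: ebas_inner eq_neg_iff_add_eq_0)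
      then show ?thesis
        using skew[of "ebas b" "ebas a"] by (simp add: inner_commute)
    qed simp
  qed
  moreover have "cliff (ebas (j, False)) (cliff (B (ebas (j, False))) ?\<Phi>)
      + cliff (ebas (j, True)) (cliff (B (ebas (j, True))) ?\<Phi>)
      = (B (axis j 1) \<bullet> axis j \<i>) *\<^sub>R ((-2 * \<i>) *s ?\<Phi>)" for j
  proof -
    have e: "ebas (j, False) = axis j 1" "ebas (j, True) = axis j \<i>" "axis j \<i> = \<i> *s axis j 1"
      by (auto simp: ebas_def axis_def vec_eq_iff)
    let ?w = "B (axis j 1)" and ?u = "axis j 1"
    have 0: "?u \<bullet> ?w = 0"
      using skew[of ?u ?u] by (simp add: inner_commute)
    have 1: "cliff ?u (cliff ?w ?\<Phi>) = - cliff ?w (cliff ?u ?\<Phi>)"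
      using clifford_relation[of ?u ?w ?\<Phi>] 0 by (simp add: eq_neg_iff_add_eq_0)
    \<comment> \<open>The further factor i, coming from \<open>clin\<close> and purity, makes the
      last term the negative of the right side of 1. Only the scalar term survives in the
      sum.\<close>
    have 2: "cliff (\<i> *s ?u) (cliff ?w ?\<Phi>)
        = (-2 * ((\<i> *s ?u) \<bullet> ?w)) *\<^sub>R ?\<Phi> - \<i> *s cliff ?w (cliff ?u ?\<Phi>)"
      using clifford_relation[of "\<i> *s ?u" ?w ?\<Phi>]
      by (simp add: cliff_ii_model_spinor cliff_smult eq_diff_eq)
    show ?thesis
      unfolding e clin cliff_ii_model_spinor cliff_smult 1 2
      by (simp add: vec_eq_iff inner_commute scaleR_conv_of_real algebra_simps)
  qed
  ultimately have "2 *\<^sub>R (\<Sum>(a, b)\<in>{(a, b). idx_less a b}. ?F a b)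
      = (\<Sum>j\<in>UNIV. (B (axis j 1) \<bullet> axis j \<i>) *\<^sub>R ((-2 * \<i>) *s ?\<Phi>))"
    by (simp only: sum_index)
  also have "\<dots> = 2 *\<^sub>R ((\<Sum>j\<in>UNIV. B (axis j 1) \<bullet> axis j \<i>) *\<^sub>R (- \<i> *s ?\<Phi>))"
    unfolding scaleR_sum_left[symmetric] by (simp add: vec_eq_iff scaleR_conv_of_real)
  finally show ?thesis by (simp only: scaleR_cancel_left) simp
qed

section \<open>Curvature of Kaehler metrics on open domains\<close>

lemma trace_mult_commute:
  fixes A B :: "'e::euclidean_space \<Rightarrow> 'e"
  assumes "linear A" "linear B"
  shows "(\<Sum>b\<in>Basis. A (B b) \<bullet> b) = (\<Sum>b\<in>Basis. B (A b) \<bullet> b)"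
proof -
  have expand: "F (H b) \<bullet> b = (\<Sum>c\<in>Basis. (H b \<bullet> c) * (F c \<bullet> b))" if "linear F"
    for F H :: "'e \<Rightarrow> 'e" and b
  proof -
    have "F (H b) = F (\<Sum>c\<in>Basis. (H b \<bullet> c) *\<^sub>R c)" by (simp only: euclidean_representation)
    also have "\<dots> = (\<Sum>c\<in>Basis. (H b \<bullet> c) *\<^sub>R F c)"
      by (simp only: linear_sum[OF that] linear_cmul[OF that])
    finally show ?thesis by (simp add: inner_sum_left)
  qed
  have "(\<Sum>b\<in>Basis. A (B b) \<bullet> b) = (\<Sum>b\<in>Basis. \<Sum>c\<in>Basis. (B b \<bullet> c) * (A c \<bullet> b))"
    by (simp only: expand[OF assms(1)])
  also have "\<dots> = (\<Sum>c\<in>Basis. \<Sum>b\<in>Basis. (A c \<bullet> b) * (B b \<bullet> c))"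
    by (subst sum.swap) (simp only: mult.commute)
  finally show ?thesis by (simp only: expand[OF assms(2)])
qed

lemma bilinear_isometry_inj:
  assumes "linear u" "\<And>v w. h (u v) (u w) = v \<bullet> w" "bilinear h"
  shows "inj u"
proof -
  have "v = 0" if "u v = 0" for v
    using assms(2)[of v v] that bilinear_lzero[OF assms(3)] by simp
  then show ?thesis using assms(1) by (simp add: linear_injective_0)
qed

lemma isometry_bij:
  fixes u :: "'e::euclidean_space \<Rightarrow> 'e"
  assumes "linear u" "\<And>v w. h (u v) (u w) = v \<bullet> w" "bilinear h"
  shows "bij u"
  using bilinear_isometry_inj[OF assms] linear_injective_imp_surjective[OF assms(1)]
  by (auto simp: bij_def)

text \<open>The summands on the left are the diagonal entries of the conjugate of F by u, and
  conjugation preserves the trace. Traces in metric frames thus become traces in the fixed basis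
  used by \<open>ricci\<close>.\<close>

lemma trace_orthonormal:
  fixes u F :: "'e::euclidean_space \<Rightarrow> 'e"
  assumes u: "linear u" "\<And>v w. h (u v) (u w) = v \<bullet> w" and h: "bilinear h" and F: "linear F"
  shows "(\<Sum>b\<in>Basis. h (F (u b)) (u b)) = (\<Sum>b\<in>Basis. F b \<bullet> b)"
proof -
  have bij: "bij u" using isometry_bij[OF u h] .
  have inv: "u (inv u v) = v" "inv u (u v) = v" for v
    using bij by (auto simp: bij_def surj_f_inv_f)
  have "linear (inv u)"
    using linear_inj_imp_surj bij u(1) by (metis bij_betw_def inj_linear_imp_inv_linear)
  then have "(\<Sum>b\<in>Basis. inv u (F (u b)) \<bullet> b) = (\<Sum>b\<in>Basis. F (u (inv u b)) \<bullet> b)"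
    using trace_mult_commute[of "inv u" "\<lambda>v. F (u v)"] linear_compose[OF u(1) F] by (simp add: o_def)
  moreover have "h (F (u b)) (u b) = inv u (F (u b)) \<bullet> b" for b
    by (metis inv(1) u(2))
  ultimately show ?thesis by (simp add: inv)
qed

text \<open>The coordinate form of \<open>cov\<close>, with G the Christoffel symbols;
  \<open>curv\<close> below is that of \<open>riem\<close>. Directions are constant vectors, so
  commutators need no bracket term.\<close>

definition nab :: "('e \<Rightarrow> 'e \<Rightarrow> 'e \<Rightarrow> 'e) \<Rightarrow> 'e \<Rightarrow> ('e \<Rightarrow> 'e) \<Rightarrow> 'e::euclidean_space \<Rightarrow> 'e" where
  "nab G X f x = dderiv f X x + G x X (f x)"

lemma nab_const: "nab G X (\<lambda>_. v) x = G x X v"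
  by (simp add: nab_def)

definition curv :: "('e \<Rightarrow> 'e \<Rightarrow> 'e \<Rightarrow> 'e) \<Rightarrow> 'e::euclidean_space \<Rightarrow> 'e \<Rightarrow> 'e \<Rightarrow> 'e \<Rightarrow> 'e" where
  "curv G x X Y Z = nab G X (nab G Y (\<lambda>_. Z)) x - nab G Y (nab G X (\<lambda>_. Z)) x"

text \<open>Every claim concerns one chart at a time. The geometry is therefore carried to an open
  subset of a Euclidean space, where tensor fields are ordinary families of multilinear
  maps.\<close>

locale kaehler_domain =
  fixes S :: "'e::euclidean_space set"
    and g :: "'e \<Rightarrow> 'e \<Rightarrow> 'e \<Rightarrow> real"
    and J :: "'e \<Rightarrow> 'e \<Rightarrow> 'e"
    and G :: "'e \<Rightarrow> 'e \<Rightarrow> 'e \<Rightarrow> 'e"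
  assumes open_S: "open S"
    and g_bilinear: "x \<in> S \<Longrightarrow> bilinear (g x)"
    and g_sym: "x \<in> S \<Longrightarrow> g x X Y = g x Y X"
    and g_smooth: "smooth_on (\<lambda>x. g x X Y) S"
    and J_linear: "x \<in> S \<Longrightarrow> linear (J x)"
    and J_square: "x \<in> S \<Longrightarrow> J x (J x X) = - X"
    and J_smooth: "smooth_on (\<lambda>x. J x X) S"
    and G_bilinear: "x \<in> S \<Longrightarrow> bilinear (G x)"
    and G_smooth: "smooth_on (\<lambda>x. G x X Y) S"
    and torsion_free: "x \<in> S \<Longrightarrow> G x X Y = G x Y X"
    and metric: "x \<in> S \<Longrightarrow> dderiv (\<lambda>x. g x Y Z) X x = g x (G x X Y) Z + g x Y (G x X Z)"
    and J_orthogonal: "x \<in> S \<Longrightarrow> g x (J x X) (J x Y) = g x X Y"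
    and J_parallel: "x \<in> S \<Longrightarrow> nab G X (\<lambda>x. J x Y) x = J x (G x X Y)"
begin

lemma nab_cong:
  assumes "x \<in> S" "\<And>y. y \<in> S \<Longrightarrow> f y = h y"
  shows "nab G X f x = nab G X h x"
  by (simp only: nab_def frechet_derivative_cong_open[OF open_S assms] assms(2)[OF assms(1)])

lemma J_skew: "x \<in> S \<Longrightarrow> g x (J x X) Y = - g x X (J x Y)"
  using J_orthogonal[of x X "J x Y"] J_square[of x Y] bilinear_rneg[OF g_bilinear]
  by fastforce

lemma
  assumes "x \<in> S" "f differentiable (at x)"
  shows G_apply_differentiable: "(\<lambda>y. G y X (f y)) differentiable (at x)"
    and dderiv_G_apply: "dderiv (\<lambda>y. G y X (f y)) Y x = dderiv (\<lambda>y. G y X (f x)) Y x + G x X (dderiv f Y x)"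
proof -
  have "linear (G y X)" if "y \<in> S" for y
    using G_bilinear[OF that] by (simp add: bilinear_def)
  from has_derivative_linear_apply[where A = "\<lambda>y. G y X", OF open_S assms(1) this
      smooth_on_differentiable[OF G_smooth assms(1)] assms(2)]
  have *: "((\<lambda>y. G y X (f y)) has_derivative
    (\<lambda>Y. dderiv (\<lambda>y. G y X (f x)) Y x + G x X (dderiv f Y x))) (at x)" .
  show "(\<lambda>y. G y X (f y)) differentiable (at x)" by (rule differentiableI[OF *])
  show "dderiv (\<lambda>y. G y X (f y)) Y x = dderiv (\<lambda>y. G y X (f x)) Y x + G x X (dderiv f Y x)"
    by (simp only: frechet_derivative_at[OF *, symmetric])
qed

lemma dderiv_J_apply:
  assumes "x \<in> S" "f differentiable (at x)"
  shows "dderiv (\<lambda>y. J y (f y)) Y x = dderiv (\<lambda>y. J y (f x)) Y x + J x (dderiv f Y x)"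
proof -
  from has_derivative_linear_apply[where A = J, OF open_S assms(1) J_linear
      smooth_on_differentiable[OF J_smooth assms(1)] assms(2)]
  have *: "((\<lambda>y. J y (f y)) has_derivative
    (\<lambda>Y. dderiv (\<lambda>y. J y (f x)) Y x + J x (dderiv f Y x))) (at x)" .
  show "dderiv (\<lambda>y. J y (f y)) Y x = dderiv (\<lambda>y. J y (f x)) Y x + J x (dderiv f Y x)"
    by (simp only: frechet_derivative_at[OF *, symmetric])
qed

text \<open>\<open>J_parallel\<close> speaks of constant fields only; the product rule extends it to
  all differentiable ones.\<close>

lemma nab_J:
  assumes "x \<in> S" "f differentiable (at x)"
  shows "nab G X (\<lambda>y. J y (f y)) x = J x (nab G X f x)"
proof -
  interpret linear "J x" using J_linear[OF assms(1)] .
  show ?thesis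
    using J_parallel[OF assms(1), of X "f x"]
    unfolding nab_def dderiv_J_apply[OF assms] add by (simp add: algebra_simps)
qed

lemma
  assumes x: "x \<in> S" and f: "f differentiable (at x)" and h: "h differentiable (at x)"
  shows metric_product_differentiable: "(\<lambda>y. g y (f y) (h y)) differentiable (at x)"
    and metric_product: "dderiv (\<lambda>y. g y (f y) (h y)) X x = g x (nab G X f x) (h x) + g x (f x) (nab G X h x)"
proof -
  from has_derivative_bilinear_apply[where B = g, OF open_S x g_bilinear
      smooth_on_differentiable[OF g_smooth x] f h]
  have *: "((\<lambda>y. g y (f y) (h y)) has_derivative (\<lambda>X. dderiv (\<lambda>y. g y (f x) (h x)) X x
    + g x (f x) (dderiv h X x) + g x (dderiv f X x) (h x))) (at x)" .
  show "(\<lambda>y. g y (f y) (h y)) differentiable (at x)" by (rule differentiableI[OF *])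
  have "dderiv (\<lambda>y. g y (f y) (h y)) X x = dderiv (\<lambda>y. g y (f x) (h x)) X x
    + g x (f x) (dderiv h X x) + g x (dderiv f X x) (h x)"
    by (simp only: frechet_derivative_at[OF *, symmetric])
  then show "dderiv (\<lambda>y. g y (f y) (h y)) X x
      = g x (nab G X f x) (h x) + g x (f x) (nab G X h x)"
    unfolding nab_def metric[OF x]
    by (simp add: bilinear_ladd[OF g_bilinear[OF x]] bilinear_radd[OF g_bilinear[OF x]])
qed

lemma nab_differentiable:
  assumes "x \<in> S" "smooth_on f S"
  shows "nab G X f differentiable (at x)"
  unfolding nab_def
  using smooth_on_differentiable[OF smooth_on_dderiv[OF assms(2)] assms(1)]
    G_apply_differentiable[OF assms(1) smooth_on_differentiable[OF assms(2) assms(1)]]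
  by (rule differentiable_add)

lemma nab_nab:
  assumes x: "x \<in> S" and f: "smooth_on f S"
  shows "nab G X (nab G Y f) x = dderiv (dderiv f Y) X x + dderiv (\<lambda>y. G y Y (f x)) X x
    + G x Y (dderiv f X x) + G x X (dderiv f Y x) + G x X (G x Y (f x))"
proof -
  note fd = smooth_on_differentiable[OF f x]
  have "dderiv (nab G Y f) X x = dderiv (dderiv f Y) X x + dderiv (\<lambda>y. G y Y (f y)) X x"
    using frechet_derivative_add[OF smooth_on_differentiable[OF smooth_on_dderiv[OF f] x]
        G_apply_differentiable[OF x fd]]
    unfolding nab_def by simp
  then show ?thesis
    unfolding nab_def[of G X] dderiv_G_apply[OF x fd]
    by (simp add: nab_def bilinear_radd[OF G_bilinear[OF x]])
qed

lemma curv_eq: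
  assumes "x \<in> S"
  shows "curv G x X Y Z = dderiv (\<lambda>y. G y Y Z) X x + G x X (G x Y Z)
    - dderiv (\<lambda>y. G y X Z) Y x - G x Y (G x X Z)"
  unfolding curv_def nab_nab[OF assms smooth_on_const]
  by (simp add: bilinear_rzero[OF G_bilinear[OF assms]])

text \<open>Second derivatives of f commute and the mixed first-order terms are symmetric in X and
  Y, so only the value of f at x remains. This gives access to the curvature through fields that are
  not constant in the chart, such as frame vectors and J applied to a constant.\<close>

lemma nab_commutator:
  assumes "x \<in> S" "smooth_on f S"
  shows "nab G X (nab G Y f) x - nab G Y (nab G X f) x = curv G x X Y (f x)"
  unfolding nab_nab[OF assms] curv_eq[OF assms(1)] dderiv_commute[OF open_S assms, of X Y]
  by (simp add: algebra_simps)

lemma curv_swap: "curv G x X Y Z = - curv G x Y X Z"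
  by (simp add: curv_def)

text \<open>By torsion-freeness the derivative terms and the quadratic terms each cancel in pairs
  under cyclic permutation.\<close>

lemma curv_bianchi:
  assumes "x \<in> S"
  shows "curv G x X Y Z + curv G x Y Z X + curv G x Z X Y = 0"
proof -
  have "dderiv (\<lambda>y. G y A B) C x = dderiv (\<lambda>y. G y B A) C x" for A B C
    by (rule fun_cong[where x = C], rule frechet_derivative_cong_open[OF open_S assms])
      (rule torsion_free)
  note sym = this[of Z Y] this[of X Z] this[of Y X]
  show ?thesis
    unfolding curv_eq[OF assms] sym torsion_free[OF assms, of Z Y] torsion_free[OF assms, of X Z]
      torsion_free[OF assms, of Y X]
    by simp
qed

lemma curv_linear_third:
  assumes "x \<in> S" shows "linear (curv G x X Y)"
proof (rule linearI)
  note S = assms and b = G_bilinear[OF assms]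
  have d: "(\<lambda>y. G y Y Z) differentiable (at x)" for Y Z
    by (rule smooth_on_differentiable[OF G_smooth S])
  fix Z W r
  have "frechet_derivative (\<lambda>y. G y Y (Z + W)) (at x) = frechet_derivative (\<lambda>y. G y Y Z + G y Y W) (at x)" for Y
    by (rule frechet_derivative_cong_open[OF open_S S]) (rule bilinear_radd[OF G_bilinear])
  then show "curv G x X Y (Z + W) = curv G x X Y Z + curv G x X Y W"
    unfolding curv_eq[OF S]
    by (simp add: bilinear_radd[OF b] frechet_derivative_add[OF d d])
  have "frechet_derivative (\<lambda>y. G y Y (r *\<^sub>R Z)) (at x) = frechet_derivative (\<lambda>y. r *\<^sub>R G y Y Z) (at x)" for Y
    by (rule frechet_derivative_cong_open[OF open_S S]) (rule bilinear_rmul[OF G_bilinear])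
  then show "curv G x X Y (r *\<^sub>R Z) = r *\<^sub>R curv G x X Y Z"
    unfolding curv_eq[OF S]
    by (simp add: bilinear_rmul[OF b] dderiv_bounded_linear[OF d bounded_linear_scaleR_right]
        scaleR_diff_right scaleR_add_right)
qed

text \<open>J is pulled through both covariant derivatives of the field J Z, whose commutator is the
  curvature at its value by \<open>nab_commutator\<close>.\<close>

lemma curv_J:
  assumes x: "x \<in> S"
  shows "curv G x X Y (J x Z) = J x (curv G x X Y Z)"
proof -
  have 1: "nab G Y (\<lambda>y. J y Z) y = J y (nab G Y (\<lambda>_. Z) y)" if "y \<in> S" for y Y
    by (rule nab_J[OF that]) simp
  have "nab G X (nab G Y (\<lambda>y. J y Z)) x = J x (nab G X (nab G Y (\<lambda>_. Z)) x)" for X Y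
    using nab_cong[OF x 1] nab_J[OF x nab_differentiable[OF x smooth_on_const]] by simp
  then have "curv G x X Y (J x Z) = J x (nab G X (nab G Y (\<lambda>_. Z)) x) - J x (nab G Y (nab G X (\<lambda>_. Z)) x)"
    using nab_commutator[OF x J_smooth, of X Y Z] by simp
  then show ?thesis by (simp add: curv_def linear_diff[OF J_linear[OF x]])
qed

text \<open>The mixed second derivatives of the function g(Z, W) agree. Expanded by the metric
  property, their difference loses the terms with one derivative on each factor, and what remains is
  the curvature on either side.\<close>

lemma curv_skew:
  assumes x: "x \<in> S"
  shows "g x (curv G x X Y Z) W = - g x Z (curv G x X Y W)"
proof -
  let ?D = "\<lambda>V. nab G V (\<lambda>_. Z)" and ?E = "\<lambda>V. nab G V (\<lambda>_. W)"
  have d: "nab G V (\<lambda>_. U) differentiable (at x)" for U V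
    by (rule nab_differentiable[OF x smooth_on_const])
  have 1: "dderiv (dderiv (\<lambda>y. g y Z W) Y) X x
      = g x (nab G X (?D Y) x) W + g x (?D Y x) (?E X x) + g x (?D X x) (?E Y x)
        + g x Z (nab G X (?E Y) x)" for X Y
  proof -
    have "frechet_derivative (dderiv (\<lambda>y. g y Z W) Y) (at x)
        = frechet_derivative (\<lambda>y. g y (?D Y y) W + g y Z (?E Y y)) (at x)"
      by (rule frechet_derivative_cong_open[OF open_S x]) (simp add: metric nab_const)
    moreover have "frechet_derivative (\<lambda>y. g y (?D Y y) W + g y Z (?E Y y)) (at x) X
      = dderiv (\<lambda>y. g y (?D Y y) W) X x + dderiv (\<lambda>y. g y Z (?E Y y)) X x"
      using frechet_derivative_add[OF metric_product_differentiable[OF x d, of "\<lambda>_. W"]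
          metric_product_differentiable[OF x _ d, of "\<lambda>_. Z"]] by simp
    ultimately show ?thesis
      using metric_product[OF x d, of "\<lambda>_. W"] metric_product[OF x _ d, of "\<lambda>_. Z"] by simp
  qed
  have "dderiv (dderiv (\<lambda>y. g y Z W) Y) X x = dderiv (dderiv (\<lambda>y. g y Z W) X) Y x"
    by (rule dderiv_commute[OF open_S x g_smooth])
  then show ?thesis
    unfolding 1 curv_def
    by (simp add: bilinear_lsub[OF g_bilinear[OF x]] bilinear_rsub[OF g_bilinear[OF x]])
qed

text \<open>Bianchi writes R(X,Y)b as R(b,Y)X - R(b,X)Y, which brings b into the slot over which
  \<open>ricci\<close> takes the trace. As J commutes with the curvature, it moves into the last
  argument.\<close>

lemma trace_J_curv:
  assumes x: "x \<in> S"
  defines "Ric \<equiv> \<lambda>Y Z. \<Sum>b\<in>Basis. curv G x b Y Z \<bullet> b"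
  shows "(\<Sum>b\<in>Basis. J x (curv G x X Y b) \<bullet> b) = Ric Y (J x X) - Ric X (J x Y)"
proof -
  have "J x (curv G x X Y b) = curv G x b Y (J x X) - curv G x b X (J x Y)" for b
  proof -
    have "curv G x X Y b = curv G x b Y X - curv G x b X Y"
      using curv_bianchi[OF x, of X Y b] curv_swap[of x Y b X]
      by (simp add: algebra_simps eq_neg_iff_add_eq_0)
    then show ?thesis by (simp add: linear_diff[OF J_linear[OF x]] curv_J[OF x])
  qed
  then show ?thesis unfolding Ric_def by (simp add: inner_diff_left sum_subtractf)
qed

end

section \<open>Unitary frames: the connection form and its complex trace\<close>

lemma skew_imp_linear:
  fixes B :: "'e::euclidean_space \<Rightarrow> 'e"
  assumes skew: "\<And>v w. B v \<bullet> w = - (v \<bullet> B w)"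
  shows "linear B"
proof (rule linearI)
  have skew': "u \<bullet> B v = - (B u \<bullet> v)" for u v
    by (simp add: skew)
  show "B (v + w) = B v + B w" for v w
    by (rule vector_eq_ldot[THEN iffD1]) (simp add: skew' inner_add_right)
  show "B (r *\<^sub>R v) = r *\<^sub>R B v" for r v
    by (rule vector_eq_ldot[THEN iffD1]) (simp add: skew')
qed

lemma ii_ebas: "\<i> *s ebas (j, False) = ebas (j, True)" "\<i> *s ebas (j, True) = - ebas (j, False)"
  by (auto simp: ebas_def axis_def vec_eq_iff)

text \<open>Complex linearity makes the terms of e_{2j-1} and e_{2j} equal, hence the factor 2. The
  sum on the right is the imaginary part of the complex trace of B.\<close>

lemma sum_unitary_pairs:
  fixes B :: "'n::finite cvec \<Rightarrow> 'n cvec"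
  assumes clin: "\<And>v. B (\<i> *s v) = \<i> *s B v"
  shows "(\<Sum>b\<in>Basis. B b \<bullet> (\<i> *s b)) = 2 * (\<Sum>j\<in>UNIV. B (axis j 1) \<bullet> axis j \<i>)"
proof -
  have "B (ebas (j, True)) \<bullet> (\<i> *s ebas (j, True)) = B (ebas (j, False)) \<bullet> ebas (j, True)" for j
    using clin[of "ebas (j, False)"] ii_ebas[of j] inner_ii_left[of "B (ebas (j, False))" "- ebas (j, False)"]
    by (simp add: vector_smult_rneg)
  then have "(\<Sum>b\<in>Basis. B b \<bullet> (\<i> *s b)) = (\<Sum>j\<in>UNIV. 2 * (B (ebas (j, False)) \<bullet> ebas (j, True)))"
    unfolding sum_Basis_ebas sum_index by (simp add: ii_ebas(1))
  then show ?thesis by (simp add: sum_distrib_left ebas_def)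
qed

locale kaehler_frame = kaehler_domain S g J G
  for S :: "'n::finite cvec set" and g J G +
  fixes E :: "'n cvec \<Rightarrow> 'n cvec \<Rightarrow> 'n cvec"
  assumes E_linear: "x \<in> S \<Longrightarrow> linear (E x)"
    and E_isometry: "x \<in> S \<Longrightarrow> g x (E x v) (E x w) = v \<bullet> w"
    and E_J: "x \<in> S \<Longrightarrow> J x (E x v) = E x (\<i> *s v)"
    and E_smooth: "smooth_on (\<lambda>x. E x v) S"
begin

text \<open>The connection matrix in the frame E, as an endomorphism of the model space. It takes
  values in u(n): \<open>conn_form_skew\<close> follows by differentiating the constant products of
  frame vectors, and \<open>conn_form_ii\<close> from J being parallel.\<close>

definition conn_form :: "'n cvec \<Rightarrow> 'n cvec \<Rightarrow> 'n cvec \<Rightarrow> 'n cvec" where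
  "conn_form X x v = inv (E x) (nab G X (\<lambda>y. E y v) x)"

lemma E_bij:
  assumes "x \<in> S" shows "bij (E x)"
  by (rule isometry_bij[OF E_linear[OF assms] E_isometry[OF assms] g_bilinear[OF assms]])

lemma E_conn_form: "x \<in> S \<Longrightarrow> E x (conn_form X x v) = nab G X (\<lambda>y. E y v) x"
  using E_bij by (simp add: conn_form_def bij_is_surj surj_f_inv_f)

lemma conn_form_inner:
  "x \<in> S \<Longrightarrow> conn_form X x v \<bullet> w = g x (nab G X (\<lambda>y. E y v) x) (E x w)"
  by (simp add: E_isometry[symmetric] E_conn_form)

lemma E_differentiable: "x \<in> S \<Longrightarrow> (\<lambda>y. E y v) differentiable (at x)"
  by (rule smooth_on_differentiable[OF E_smooth])

lemma conn_form_skew: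
  assumes x: "x \<in> S"
  shows "conn_form X x v \<bullet> w = - (v \<bullet> conn_form X x w)"
proof -
  have "frechet_derivative (\<lambda>y. g y (E y v) (E y w)) (at x) = frechet_derivative (\<lambda>y. v \<bullet> w) (at x)"
    by (rule frechet_derivative_cong_open[OF open_S x]) (rule E_isometry)
  then have "g x (nab G X (\<lambda>y. E y v) x) (E x w) + g x (E x v) (nab G X (\<lambda>y. E y w) x) = 0"
    using metric_product[OF x E_differentiable[OF x] E_differentiable[OF x], of v w X] by simp
  then show ?thesis
    using x by (simp add: conn_form_inner inner_commute[of v] g_sym[OF x, of "E x v"])
qed

lemma conn_form_linear: "x \<in> S \<Longrightarrow> linear (conn_form X x)"
  by (rule skew_imp_linear) (rule conn_form_skew)

lemma conn_form_ii:
  assumes x: "x \<in> S"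
  shows "conn_form X x (\<i> *s v) = \<i> *s conn_form X x v"
proof -
  have "nab G X (\<lambda>y. E y (\<i> *s v)) x = nab G X (\<lambda>y. J y (E y v)) x"
    by (rule nab_cong[OF x]) (simp add: E_J)
  also have "\<dots> = J x (nab G X (\<lambda>y. E y v) x)"
    by (rule nab_J[OF x E_differentiable[OF x]])
  finally have "E x (conn_form X x (\<i> *s v)) = E x (\<i> *s conn_form X x v)"
    by (simp add: E_conn_form x E_J[symmetric])
  then show ?thesis using E_bij[OF x] by (simp add: bij_def inj_eq)
qed

text \<open>The imaginary part of the complex trace. The real part is zero by skewness, so i times
  this number is the connection form induced on the determinant.\<close>

definition conn_trace :: "'n cvec \<Rightarrow> 'n cvec \<Rightarrow> real" where
  "conn_trace X x = (\<Sum>j\<in>UNIV. conn_form X x (axis j 1) \<bullet> axis j \<i>)"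

text \<open>Free of \<open>inv (E x)\<close>, the trace becomes a sum of metric products of fields,
  which \<open>metric_product\<close> can differentiate.\<close>

lemma conn_trace_eq:
  "x \<in> S \<Longrightarrow> conn_trace X x = 1/2 * (\<Sum>b\<in>Basis. g x (nab G X (\<lambda>y. E y b) x) (E x (\<i> *s b)))"
  using sum_unitary_pairs[of "conn_form X x", OF conn_form_ii]
  by (simp add: conn_trace_def conn_form_inner)

text \<open>The quadratic term in the derivative of the trace. Exchanging X and Y changes its sign
  because i is skew, and leaves it unchanged because the trace is cyclic and the forms are skew and
  complex linear.\<close>

lemma conn_form_commutator_trace:
  assumes x: "x \<in> S"
  shows "(\<Sum>b\<in>Basis. conn_form Y x b \<bullet> conn_form X x (\<i> *s b)) = 0"
proof -
  let ?B = "\<lambda>X. conn_form X x"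
  let ?Q = "\<lambda>Y X. \<Sum>b\<in>Basis. ?B Y b \<bullet> (\<i> *s ?B X b)"
  have anti: "?Q Y X = - ?Q X Y" for X Y
    unfolding sum_negf[symmetric]
    by (intro sum.cong refl) (simp add: inner_ii_left[of "?B X _", symmetric] inner_commute)
  have ii_linear: "linear (\<lambda>v. \<i> *s ?B X v)" for X
    using conn_form_linear[OF x, of X]
    by (auto intro!: linearI simp: linear_add linear_cmul vector_add_ldistrib smult_scaleR_commute)
  have "?Q Y X = - (\<Sum>b\<in>Basis. ?B Y (\<i> *s ?B X b) \<bullet> b)"
    unfolding sum_negf[symmetric]
    by (intro sum.cong refl) (metis conn_form_skew[OF x] inner_commute)
  also have "\<dots> = - (\<Sum>b\<in>Basis. (\<i> *s ?B X (?B Y b)) \<bullet> b)"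
    by (simp only: trace_mult_commute[OF conn_form_linear[OF x] ii_linear])
  also have "\<dots> = ?Q X Y"
    unfolding sum_negf[symmetric]
  proof (intro sum.cong refl)
    fix b
    show "- ((\<i> *s ?B X (?B Y b)) \<bullet> b) = ?B X b \<bullet> (\<i> *s ?B Y b)"
      using conn_form_skew[OF x, of X b "\<i> *s ?B Y b"]
      by (simp only: conn_form_ii[OF x] inner_commute[of _ b])
  qed
  finally have "?Q Y X = 0" using anti[of Y X] by simp
  then show ?thesis by (simp add: conn_form_ii[OF x])
qed

lemma
  assumes x: "x \<in> S"
  shows conn_trace_differentiable: "conn_trace Y differentiable (at x)"
    and dderiv_conn_trace: "dderiv (conn_trace Y) X x
      = 1/2 * (\<Sum>b\<in>Basis. g x (nab G X (nab G Y (\<lambda>y. E y b)) x) (E x (\<i> *s b)))"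
proof -
  let ?n = "\<lambda>X b. nab G X (\<lambda>y. E y b)"
  have nd: "?n Y b differentiable (at x)" for Y b
    by (rule nab_differentiable[OF x E_smooth])
  note md = metric_product_differentiable[OF x nd E_differentiable[OF x]]
  let ?h = "\<lambda>x. \<Sum>b\<in>Basis. g x (?n Y b x) (E x (\<i> *s b))"
  have hd: "?h differentiable (at x)"
    by (intro differentiable_sum finite_Basis ballI md)
  then obtain D where D: "((\<lambda>x. 1/2 * ?h x) has_derivative D) (at x)"
    using differentiable_mult[OF differentiable_const hd] unfolding differentiable_def by blast
  have "(conn_trace Y has_derivative D) (at x)"
    by (rule has_derivative_transform_within_open[OF D open_S x]) (rule conn_trace_eq[symmetric])
  then show "conn_trace Y differentiable (at x)" by (rule differentiableI)
  have "frechet_derivative (conn_trace Y) (at x) = frechet_derivative (\<lambda>x. 1/2 * ?h x) (at x)"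
    by (rule frechet_derivative_cong_open[OF open_S x]) (rule conn_trace_eq)
  then have "dderiv (conn_trace Y) X x = dderiv (\<lambda>x. 1/2 * ?h x) X x" by (simp only:)
  also have "\<dots> = 1/2 * dderiv ?h X x"
    by (rule dderiv_bounded_linear[OF hd bounded_linear_mult_right])
  also have "dderiv ?h X x
      = (\<Sum>b\<in>Basis. g x (nab G X (?n Y b) x) (E x (\<i> *s b)) + g x (?n Y b x) (?n X (\<i> *s b) x))"
    by (simp only: frechet_derivative_sum[OF md] metric_product[OF x nd E_differentiable[OF x]])
  also have "\<dots> = (\<Sum>b\<in>Basis. g x (nab G X (?n Y b) x) (E x (\<i> *s b)))
      + (\<Sum>b\<in>Basis. conn_form Y x b \<bullet> conn_form X x (\<i> *s b))"
    by (simp add: sum.distrib conn_form_inner E_conn_form x)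
  finally show "dderiv (conn_trace Y) X x
      = 1/2 * (\<Sum>b\<in>Basis. g x (nab G X (?n Y b) x) (E x (\<i> *s b)))"
    by (simp add: conn_form_commutator_trace[OF x])
qed

text \<open>The trace of Cartan's structure equation: antisymmetrizing
  \<open>dderiv_conn_trace\<close> produces the commutator of covariant derivatives on the frame
  vectors. The vector E(ib) is J E b, and moving J across the metric gives the minus sign.\<close>

lemma curvature_conn_trace:
  assumes x: "x \<in> S"
  shows "dderiv (conn_trace Y) X x - dderiv (conn_trace X) Y x
    = - (1/2) * (\<Sum>b\<in>Basis. J x (curv G x X Y b) \<bullet> b)"
proof -
  have "dderiv (conn_trace Y) X x - dderiv (conn_trace X) Y x
      = 1/2 * (\<Sum>b\<in>Basis. g x (curv G x X Y (E x b)) (E x (\<i> *s b)))"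
    unfolding dderiv_conn_trace[OF x] right_diff_distrib[symmetric] sum_subtractf[symmetric]
      bilinear_lsub[OF g_bilinear[OF x], symmetric] nab_commutator[OF x E_smooth] ..
  also have "\<dots> = 1/2 * (\<Sum>b\<in>Basis. - g x (J x (curv G x X Y (E x b))) (E x b))"
    by (simp add: E_J[OF x, symmetric] J_skew[OF x])
  also have "\<dots> = - (1/2) * (\<Sum>b\<in>Basis. J x (curv G x X Y b) \<bullet> b)"
    using trace_orthonormal[OF E_linear[OF x] E_isometry[OF x] g_bilinear[OF x],
        of "\<lambda>v. J x (curv G x X Y v)"]
      linear_compose[OF curv_linear_third[OF x] J_linear[OF x], of X Y]
    by (simp add: sum_negf o_def)
  finally show ?thesis .
qed

end

text \<open>R(X,Y) and J are both skew, so the product of their entries is symmetric with zero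
  diagonal, and the ordered sum is half the full one. Parseval over the second index contracts it to
  g(R u_a, J u_a).\<close>

lemma (in kaehler_domain) curvature_operator_fundamental_form:
  fixes u :: "'n::{finite,linorder} cvec \<Rightarrow> 'e"
  assumes x: "x \<in> S" and u: "linear u" "\<And>v w. g x (u v) (u w) = v \<bullet> w" "surj u"
  shows "(\<Sum>(a, b)\<in>{(a, b). idx_less a b}.
      g x (curv G x X Y (u (ebas a))) (u (ebas b)) * g x (J x (u (ebas a))) (u (ebas b)))
    = - (1/2) * (\<Sum>b\<in>Basis. g x (J x (curv G x X Y (u b))) (u b))"
proof -
  let ?R = "curv G x X Y"
  let ?F = "\<lambda>a b. g x (?R (u (ebas a))) (u (ebas b)) * g x (J x (u (ebas a))) (u (ebas b))"
  have parseval: "(\<Sum>b\<in>UNIV. g x A (u (ebas b)) * g x B (u (ebas b))) = g x A B" for A B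
  proof -
    obtain v w where vw: "A = u v" "B = u w" using u(3) by (meson surjD)
    show ?thesis
      unfolding vw u(2) euclidean_inner[of v w] sum_Basis_ebas ..
  qed
  have "2 *\<^sub>R (\<Sum>(a, b)\<in>{(a, b). idx_less a b}. ?F a b) = (\<Sum>a\<in>UNIV. \<Sum>b\<in>UNIV. ?F a b)"
  proof (rule sum_idx_less)
    have neg: "g x (?R A) B = - g x (?R B) A" "g x (J x A) B = - g x (J x B) A" for A B
      using curv_skew[OF x, of X Y A B] J_skew[OF x, of A B] g_sym[OF x] by simp_all
    show "?F b a = ?F a b" for a b
      by (subst neg, subst (2) neg) simp
    show "?F a a = 0" for a
      using neg(2)[of "u (ebas a)" "u (ebas a)"] by simp
  qed
  also have "\<dots> = (\<Sum>a\<in>UNIV. g x (?R (u (ebas a))) (J x (u (ebas a))))"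
    by (simp only: parseval)
  also have "\<dots> = - (\<Sum>b\<in>Basis. g x (J x (?R (u b))) (u b))"
    by (simp add: sum_Basis_ebas J_skew[OF x] sum_negf)
  finally show ?thesis by simp
qed

section \<open>Pullback to charts\<close>

lemma smooth_in_pullback:
  assumes "smooth_in C W f" "V \<subseteq> W"
  shows "smooth_on (\<lambda>x. f (chart_inv C x)) (snd C ` V)"
  using smooth_on_subset[OF assms(1)[unfolded smooth_in_def] image_mono[OF assms(2)]]
  by (simp add: o_def)

context
  fixes \<A> :: "('a::{t2_space, second_countable_topology}, 'n::{finite, linorder}) chart set"
    and g :: "('a, 'n) form2" and J :: "('a, 'n) endo" and \<Gamma> :: "('a, 'n) conn"
  assumes kaehler: "kaehler_manifold \<A> g J \<Gamma>"
begin

lemma chart_inv_left: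
  assumes "C \<in> \<A>" "p \<in> fst C" shows "chart_inv C (snd C p) = p"
proof -
  have "is_chart C" using kaehler assms(1) by (simp add: kaehler_manifold_def smooth_atlas_def)
  then have "homeomorphism (fst C) (snd C ` fst C) (snd C) (chart_inv C)"
    unfolding is_chart_def by blast
  then show ?thesis using assms(2) by (rule homeomorphism_apply1)
qed

lemma open_chart_image:
  assumes "C \<in> \<A>" "open V" "V \<subseteq> fst C" shows "open (snd C ` V)"
proof -
  have "is_chart C" using kaehler assms(1) by (simp add: kaehler_manifold_def smooth_atlas_def)
  then have h: "homeomorphism (fst C) (snd C ` fst C) (snd C) (chart_inv C)"
    and o: "open (snd C ` fst C)" by (auto simp: is_chart_def)
  have "openin (top_of_set (fst C)) V"
    using assms(2,3) by (auto simp: openin_open)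
  from homeomorphism_imp_open_map[OF h this] o show ?thesis
    using openin_open_eq by blast
qed

lemma metric_bilinear: "C \<in> \<A> \<Longrightarrow> p \<in> fst C \<Longrightarrow> bilinear (g C p)"
  and metric_sym: "C \<in> \<A> \<Longrightarrow> p \<in> fst C \<Longrightarrow> g C p X Y = g C p Y X"
  and metric_pos: "C \<in> \<A> \<Longrightarrow> p \<in> fst C \<Longrightarrow> X \<noteq> 0 \<Longrightarrow> g C p X X > 0"
  using kaehler by (simp_all add: kaehler_manifold_def riemannian_metric_def)

lemma cov_eq_nab:
  assumes "C \<in> \<A>" "p \<in> fst C"
  shows "cov \<Gamma> C X f p = nab (\<lambda>x. \<Gamma> C (chart_inv C x)) X (\<lambda>x. f (chart_inv C x)) (snd C p)"
  by (simp add: cov_def pderiv_in_def nab_def chart_inv_left[OF assms] o_def)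

lemma kaehler_frame_of_local_unitary_frame:
  assumes e: "local_unitary_frame \<A> g J C V e"
  shows "kaehler_frame (snd C ` V) (\<lambda>x. g C (chart_inv C x)) (\<lambda>x. J C (chart_inv C x))
    (\<lambda>x. \<Gamma> C (chart_inv C x)) (\<lambda>x. e (chart_inv C x))"
proof -
  have C: "C \<in> \<A>" and V: "open V" "V \<subseteq> fst C"
    and u: "\<And>p. p \<in> V \<Longrightarrow> unitary_frame g J C p (e p)"
    and es: "\<And>v. smooth_in C V (\<lambda>p. e p v)"
    using e unfolding local_unitary_frame_def by auto
  have inv: "chart_inv C (snd C p) = p" if "p \<in> V" for p
    using chart_inv_left[OF C] that V(2) by blast
  have rm: "riemannian_metric \<A> g" and ac: "almost_complex_structure \<A> J"
    and lc: "levi_civita \<A> g \<Gamma>" and af: "affine_connection \<A> \<Gamma>"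
    using kaehler by (simp_all add: kaehler_manifold_def levi_civita_def)
  show ?thesis
  proof (intro kaehler_frame.intro kaehler_domain.intro kaehler_frame_axioms.intro)
    show "open (snd C ` V)" by (rule open_chart_image[OF C V])
    show "smooth_on (\<lambda>x. g C (chart_inv C x) X Y) (snd C ` V)" for X Y
      by (rule smooth_in_pullback[where f = "\<lambda>p. g C p X Y", OF _ V(2)])
        (use rm C in \<open>simp add: riemannian_metric_def\<close>)
    show "smooth_on (\<lambda>x. J C (chart_inv C x) X) (snd C ` V)" for X
      by (rule smooth_in_pullback[where f = "\<lambda>p. J C p X", OF _ V(2)])
        (use ac C in \<open>simp add: almost_complex_structure_def\<close>)
    show "smooth_on (\<lambda>x. \<Gamma> C (chart_inv C x) X Y) (snd C ` V)" for X Y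
      by (rule smooth_in_pullback[where f = "\<lambda>p. \<Gamma> C p X Y", OF _ V(2)])
        (use af C in \<open>simp add: affine_connection_def\<close>)
    show "smooth_on (\<lambda>x. e (chart_inv C x) v) (snd C ` V)" for v
      using es[of v] by (simp add: smooth_in_def o_def)
    fix x assume "x \<in> snd C ` V"
    then obtain p where p: "p \<in> V" "x = snd C p" by blast
    then have x: "chart_inv C x = p" and pC: "p \<in> fst C" using inv V by auto
    show "bilinear (g C (chart_inv C x))"
      unfolding x by (rule metric_bilinear[OF C pC])
    show "linear (J C (chart_inv C x))"
      unfolding x using ac C pC by (simp add: almost_complex_structure_def)
    show "bilinear (\<Gamma> C (chart_inv C x))"
      unfolding x using af C pC by (simp add: affine_connection_def)
    show "g C (chart_inv C x) X Y = g C (chart_inv C x) Y X" for X Y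
      unfolding x by (rule metric_sym[OF C pC])
    show "J C (chart_inv C x) (J C (chart_inv C x) X) = - X" for X
      unfolding x using ac C pC by (simp add: almost_complex_structure_def)
    show "\<Gamma> C (chart_inv C x) X Y = \<Gamma> C (chart_inv C x) Y X" for X Y
      unfolding x using lc C pC unfolding levi_civita_def by blast
    show "g C (chart_inv C x) (J C (chart_inv C x) X) (J C (chart_inv C x) Y)
        = g C (chart_inv C x) X Y" for X Y
      unfolding x using kaehler C pC unfolding kaehler_manifold_def by blast
    have "pderiv_in C (\<lambda>q. g C q Y Z) X p = g C p (\<Gamma> C p X Y) Z + g C p Y (\<Gamma> C p X Z)" for X Y Z
      using lc C pC by (simp add: levi_civita_def)
    then show "dderiv (\<lambda>x. g C (chart_inv C x) Y Z) X x
        = g C (chart_inv C x) (\<Gamma> C (chart_inv C x) X Y) Z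
          + g C (chart_inv C x) Y (\<Gamma> C (chart_inv C x) X Z)" for X Y Z
      unfolding x by (simp add: pderiv_in_def o_def p(2))
    have "cov \<Gamma> C X (\<lambda>q. J C q Y) p = J C p (cov \<Gamma> C X (\<lambda>_. Y) p)" for X Y
      using kaehler C pC by (simp add: kaehler_manifold_def)
    then show "nab (\<lambda>x. \<Gamma> C (chart_inv C x)) X (\<lambda>x. J C (chart_inv C x) Y) x
        = J C (chart_inv C x) (\<Gamma> C (chart_inv C x) X Y)" for X Y
      unfolding cov_eq_nab[OF C pC] nab_const by (simp add: x p(2)[symmetric])
    show "linear (e (chart_inv C x))"
      using u[OF p(1)] unfolding x by (auto simp: unitary_frame_def orthonormal_frame_def)
    show "g C (chart_inv C x) (e (chart_inv C x) v) (e (chart_inv C x) w) = v \<bullet> w" for v w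
      using u[OF p(1)] unfolding x by (auto simp: unitary_frame_def orthonormal_frame_def)
    show "J C (chart_inv C x) (e (chart_inv C x) v) = e (chart_inv C x) (\<i> *s v)" for v
      using u[OF p(1)] unfolding x by (auto simp: unitary_frame_def orthonormal_frame_def)
  qed
qed

text \<open>The inner covariant derivatives agree only over V; since its image is open, this
  suffices for the outer derivative.\<close>

lemma riem_eq_curv:
  assumes "local_unitary_frame \<A> g J C V e" "p \<in> V"
  shows "riem \<Gamma> C p X Y Z = curv (\<lambda>x. \<Gamma> C (chart_inv C x)) (snd C p) X Y Z"
proof -
  interpret kaehler_frame "snd C ` V" "\<lambda>x. g C (chart_inv C x)" "\<lambda>x. J C (chart_inv C x)"
    "\<lambda>x. \<Gamma> C (chart_inv C x)" "\<lambda>x. e (chart_inv C x)"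
    by (rule kaehler_frame_of_local_unitary_frame[OF assms(1)])
  have C: "C \<in> \<A>" "V \<subseteq> fst C" using assms(1) by (auto simp: local_unitary_frame_def)
  have 1: "cov \<Gamma> C Y (\<lambda>_. Z) (chart_inv C y) = nab (\<lambda>x. \<Gamma> C (chart_inv C x)) Y (\<lambda>_. Z) y"
    if "y \<in> snd C ` V" for y Y
    using that C cov_eq_nab[OF C(1), of _ Y "\<lambda>_. Z"] chart_inv_left[OF C(1)] by auto
  have "cov \<Gamma> C X (cov \<Gamma> C Y (\<lambda>_. Z)) p
      = nab (\<lambda>x. \<Gamma> C (chart_inv C x)) X (nab (\<lambda>x. \<Gamma> C (chart_inv C x)) Y (\<lambda>_. Z)) (snd C p)" for X Y
    unfolding cov_eq_nab[OF C(1) subsetD[OF C(2) assms(2)], of X]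
    by (rule nab_cong) (use assms(2) 1 in auto)
  then show ?thesis by (simp add: riem_def curv_def)
qed

lemma unitary_frame_inv:
  assumes "C \<in> \<A>" "p \<in> fst C" "unitary_frame g J C p u"
  shows "u (inv u X) = X"
proof -
  have "bij u"
    by (rule isometry_bij[OF _ _ metric_bilinear[OF assms(1,2)]])
      (use assms(3) in \<open>auto simp: unitary_frame_def orthonormal_frame_def\<close>)
  then show ?thesis by (simp add: bij_is_surj surj_f_inv_f)
qed

text \<open>The form is quadratic in the spinor, hence the square of c; for c = 1 it is the
  fundamental form of the Kaehler metric.\<close>

lemma eta12_fundamental_form:
  assumes Cp: "C \<in> \<A>" "p \<in> fst C" and u: "unitary_frame g J C p u"
    and psi: "\<psi> C p u = c *\<^sub>R model_spinor"
  shows "eta12 g \<psi> C p u = (\<lambda>X Y. c\<^sup>2 * g C p (J C p X) Y)"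
proof (intro ext)
  fix X Y
  define x y where "x = inv u X" and "y = inv u Y"
  have X: "X = u x" and Y: "Y = u y"
    by (simp_all add: x_def y_def unitary_frame_inv[OF Cp u])
  have g: "g C p (u v) (u w) = v \<bullet> w" and J: "J C p (u v) = u (\<i> *s v)" for v w
    using u by (auto simp: unitary_frame_def orthonormal_frame_def)
  have "wedge_act g C p u X Y (f12 (\<psi> C p u))
      = c *\<^sub>R (cliff x (cliff y (f12 model_spinor)) + (x \<bullet> y) *\<^sub>R f12 model_spinor)"
    unfolding wedge_act_def psi f12_scaleR cliff_scaleR_right x_def[symmetric] y_def[symmetric]
    by (simp add: X Y g scaleR_add_right mult.commute)
  then have "eta12 g \<psi> C p u X Y = c\<^sup>2 * ((\<i> *s x) \<bullet> y)"
    unfolding eta12_def psi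
    by (simp add: herm_scaleR_left herm_scaleR_right re_herm_f12_model power2_eq_square)
  then show "eta12 g \<psi> C p u X Y = c\<^sup>2 * g C p (J C p X) Y"
    by (simp add: X Y J g)
qed

lemma eta12_hat_complex_structure:
  assumes Cp: "C \<in> \<A>" "p \<in> fst C" and u: "unitary_frame g J C p u"
    and psi: "\<psi> C p u = model_spinor"
  shows "eta12_hat g \<psi> C p u = J C p"
proof
  fix X
  have eta: "eta12 g \<psi> C p u X Y = g C p (J C p X) Y" for Y
    using eta12_fundamental_form[OF Cp u, of \<psi> 1] psi by simp
  show "eta12_hat g \<psi> C p u X = J C p X"
    unfolding eta12_hat_def eta
  proof (rule the_equality)
    fix Z assume Z: "\<forall>Y. g C p Z Y = g C p (J C p X) Y"
    \<comment> \<open>Uniqueness for the \<open>THE\<close> in \<open>eta12_hat\<close>: the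
      difference of two solutions has length zero.\<close>
    have "g C p (Z - J C p X) (Z - J C p X) = 0"
      using Z by (simp add: bilinear_lsub[OF metric_bilinear[OF Cp]])
    then show "Z = J C p X"
      using metric_pos[OF Cp, of "Z - J C p X"] by fastforce
  qed simp
qed

text \<open>The diagonal entries of a skew-Hermitian matrix are imaginary, so its trace is i times
  the sum of their imaginary parts.\<close>

lemma aux_connection_eq:
  assumes e: "local_unitary_frame \<A> g J C V e" and p: "p \<in> V"
  shows "canonical_aux_connection \<Gamma> C e p X = \<i> * of_real (kaehler_frame.conn_trace
    (\<lambda>x. \<Gamma> C (chart_inv C x)) (\<lambda>x. e (chart_inv C x)) X (snd C p))"
proof -
  interpret kaehler_frame "snd C ` V" "\<lambda>x. g C (chart_inv C x)" "\<lambda>x. J C (chart_inv C x)"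
    "\<lambda>x. \<Gamma> C (chart_inv C x)" "\<lambda>x. e (chart_inv C x)"
    by (rule kaehler_frame_of_local_unitary_frame[OF e])
  have C: "C \<in> \<A>" "p \<in> fst C" using e p by (auto simp: local_unitary_frame_def)
  have x: "snd C p \<in> snd C ` V" using p by simp
  let ?B = "conn_form X (snd C p)"
  have "canonical_aux_connection \<Gamma> C e p X = (\<Sum>j\<in>UNIV. ?B (axis j 1) $ j)"
    by (simp add: canonical_aux_connection_def trace_def conn_form_def cov_eq_nab[OF C] chart_inv_left[OF C])
  also have "\<dots> = (\<Sum>j\<in>UNIV. \<i> * of_real (?B (axis j 1) \<bullet> axis j \<i>))"
  proof (rule sum.cong[OF refl])
    fix j
    have "?B (axis j 1) \<bullet> axis j 1 = 0"
      using conn_form_skew[OF x, of X "axis j 1" "axis j 1"] by (simp add: inner_commute)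
    then show "?B (axis j 1) $ j = \<i> * of_real (?B (axis j 1) \<bullet> axis j \<i>)"
      by (simp add: inner_axis complex_eq_iff inner_complex_def)
  qed
  finally show ?thesis by (simp add: conn_trace_def sum_distrib_left)
qed

text \<open>With t the value of \<open>conn_trace\<close>, the Levi-Civita part acts as
  \<open>- \<i> t / 2\<close> and the auxiliary part as \<open>\<i> t / 2\<close>. The constant c
  covers the rescaled spinors of the Einstein case.\<close>

lemma spin_cov_model_spinor:
  assumes e: "local_unitary_frame \<A> g J C V e" and p: "p \<in> V"
    and psi: "\<And>q. q \<in> V \<Longrightarrow> \<psi> C q (e q) = c *\<^sub>R model_spinor"
  shows "spin_cov g \<Gamma> (canonical_aux_connection \<Gamma>) \<psi> C e p X = 0"
proof -
  interpret kaehler_frame "snd C ` V" "\<lambda>x. g C (chart_inv C x)" "\<lambda>x. J C (chart_inv C x)"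
    "\<lambda>x. \<Gamma> C (chart_inv C x)" "\<lambda>x. e (chart_inv C x)"
    by (rule kaehler_frame_of_local_unitary_frame[OF e])
  have C: "C \<in> \<A>" "V \<subseteq> fst C" using e by (auto simp: local_unitary_frame_def)
  have pC: "p \<in> fst C" using p C by blast
  have x: "snd C p \<in> snd C ` V" using p by simp
  have inv: "chart_inv C (snd C q) = q" if "q \<in> V" for q
    using chart_inv_left[OF C(1)] that C(2) by blast
  let ?B = "conn_form X (snd C p)" and ?t = "conn_trace X (snd C p)"
  have "frechet_derivative (\<lambda>x. \<psi> C (chart_inv C x) (e (chart_inv C x))) (at (snd C p))
      = frechet_derivative (\<lambda>x. c *\<^sub>R model_spinor) (at (snd C p))"
    by (rule frechet_derivative_cong_open[OF open_S x]) (use inv psi in auto)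
  then have 0: "pderiv_in C (\<lambda>q. \<psi> C q (e q)) X p = 0"
    by (simp add: pderiv_in_def o_def)
  have om: "omega g \<Gamma> C e p X a b = ?B (ebas a) \<bullet> ebas b" for a b
    by (simp add: omega_def conn_form_inner[OF x] cov_eq_nab[OF C(1) pC] inv[OF p])
  have th: "theta12 (canonical_aux_connection \<Gamma>) C e p X = ?t"
    by (simp add: theta12_def fcov_def pderiv_in_def o_def aux_connection_eq[OF e p] inner_complex_def)
  have "(\<Sum>(a, b)\<in>{(a, b). idx_less a b}. omega g \<Gamma> C e p X a b *\<^sub>R
        cliff (ebas a) (cliff (ebas b) (\<psi> C p (e p))))
      = c *\<^sub>R (\<Sum>(a, b)\<in>{(a, b). idx_less a b}. (?B (ebas a) \<bullet> ebas b) *\<^sub>R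
        cliff (ebas a) (cliff (ebas b) model_spinor))"
    unfolding scaleR_sum_right
    by (intro sum.cong refl) (auto simp: om psi[OF p] cliff_scaleR_right)
  also have "\<dots> = c *\<^sub>R (?t *\<^sub>R (- \<i> *s model_spinor))"
    by (simp only: spin_action_model_spinor[OF conn_form_skew[OF x] conn_form_ii[OF x]] conn_trace_def)
  finally show ?thesis
    unfolding spin_cov_def 0 th psi[OF p] f12_scaleR f12_model_spinor
    by (simp add: vec_eq_iff)
qed

lemma Theta12_eq_trace:
  assumes e: "local_unitary_frame \<A> g J C V e" and p: "p \<in> V"
  shows "Theta12 (canonical_aux_connection \<Gamma>) C e p X Y
    = 1/2 * (\<Sum>b\<in>Basis. J C p (riem \<Gamma> C p X Y b) \<bullet> b)"
proof -
  interpret kaehler_frame "snd C ` V" "\<lambda>x. g C (chart_inv C x)" "\<lambda>x. J C (chart_inv C x)"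
    "\<lambda>x. \<Gamma> C (chart_inv C x)" "\<lambda>x. e (chart_inv C x)"
    by (rule kaehler_frame_of_local_unitary_frame[OF e])
  have C: "C \<in> \<A>" "V \<subseteq> fst C" using e by (auto simp: local_unitary_frame_def)
  have x: "snd C p \<in> snd C ` V" using p by simp
  have inv: "chart_inv C (snd C q) = q" if "q \<in> V" for q
    using chart_inv_left[OF C(1)] that C(2) by blast
  let ?\<theta> = "canonical_aux_connection \<Gamma>"
  \<comment> \<open>The connection form is i times a real number and maps f_2 = i to the real value
    - t. Applying the form once more yields an imaginary quadratic term, invisible to the pairing
    with f_1 = 1.\<close>
  have 1: "fcov ?\<theta> C e X (fcov ?\<theta> C e Y (\<lambda>_. \<i>)) p \<bullet> 1 = - dderiv (conn_trace Y) X (snd C p)" for X Y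
  proof -
    have f: "fcov ?\<theta> C e Y (\<lambda>_. \<i>) q = of_real (- conn_trace Y (snd C q))" if "q \<in> V" for q
      by (simp add: fcov_def pderiv_in_def o_def aux_connection_eq[OF e that] complex_eq_iff)
    have "frechet_derivative (\<lambda>x. fcov ?\<theta> C e Y (\<lambda>_. \<i>) (chart_inv C x)) (at (snd C p))
        = frechet_derivative (\<lambda>x. complex_of_real (- conn_trace Y x)) (at (snd C p))"
      by (rule frechet_derivative_cong_open[OF open_S x]) (use inv f in auto)
    then have "dderiv (\<lambda>x. fcov ?\<theta> C e Y (\<lambda>_. \<i>) (chart_inv C x)) X (snd C p)
        = dderiv (\<lambda>x. complex_of_real (- conn_trace Y x)) X (snd C p)" by (simp only:)
    also have "\<dots> = of_real (- dderiv (conn_trace Y) X (snd C p))"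
      by (rule dderiv_bounded_linear[OF conn_trace_differentiable[OF x]])
        (rule bounded_linear_compose[OF bounded_linear_of_real bounded_linear_minus[OF bounded_linear_ident]])
    finally show ?thesis
      unfolding fcov_def[of _ _ _ X] f[OF p]
      by (simp add: pderiv_in_def o_def aux_connection_eq[OF e p] inner_complex_def)
  qed
  show ?thesis
    unfolding Theta12_def aux_curvature_def inner_diff_left 1 riem_eq_curv[OF e p]
    using curvature_conn_trace[OF x, of Y X] by (simp add: inv[OF p])
qed

text \<open>A unitary frame at p witnesses the choice in \<open>some_frame\<close>.\<close>

lemma some_frame_orthonormal:
  assumes "unitary_frame g J C p u" shows "orthonormal_frame g C p (some_frame g C p)"
  unfolding some_frame_def
  by (rule someI[of _ u]) (use assms in \<open>simp add: unitary_frame_def\<close>)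

text \<open>The chosen frame is orthonormal but need not be adapted to J. The sum is first a trace
  over that frame, and \<open>trace_orthonormal\<close> removes the dependence on it.\<close>

lemma curv_op_fundamental_form:
  assumes e: "local_unitary_frame \<A> g J C V e" and p: "p \<in> V"
  shows "curv_op g \<Gamma> C p (\<lambda>X Y. g C p (J C p X) Y) X Y
    = - (1/2) * (\<Sum>b\<in>Basis. J C p (riem \<Gamma> C p X Y b) \<bullet> b)"
proof -
  interpret kaehler_frame "snd C ` V" "\<lambda>x. g C (chart_inv C x)" "\<lambda>x. J C (chart_inv C x)"
    "\<lambda>x. \<Gamma> C (chart_inv C x)" "\<lambda>x. e (chart_inv C x)"
    by (rule kaehler_frame_of_local_unitary_frame[OF e])
  have C: "C \<in> \<A>" "p \<in> fst C" and u: "unitary_frame g J C p (e p)"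
    using e p by (auto simp: local_unitary_frame_def)
  have x: "snd C p \<in> snd C ` V" using p by simp
  have inv: "chart_inv C (snd C p) = p" by (rule chart_inv_left[OF C])
  let ?u = "some_frame g C p"
  have lin: "linear ?u" and iso: "g C p (?u v) (?u w) = v \<bullet> w" for v w
    using some_frame_orthonormal[OF u] by (auto simp: orthonormal_frame_def)
  have surj: "surj ?u"
    using isometry_bij[OF lin iso metric_bilinear[OF C]] by (rule bij_is_surj)
  note riem = riem_eq_curv[OF e p, symmetric]
  have "curv_op g \<Gamma> C p (\<lambda>X Y. g C p (J C p X) Y) X Y
      = - (1/2) * (\<Sum>b\<in>Basis. g C p (J C p (riem \<Gamma> C p X Y (?u b))) (?u b))"
    using curvature_operator_fundamental_form[OF x lin, of X Y] iso surj
    by (simp add: curv_op_def riem4_def inv riem)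
  moreover have "linear (\<lambda>v. J C p (riem \<Gamma> C p X Y v))"
    using linear_compose[OF curv_linear_third[OF x] J_linear[OF x], of X Y]
    by (simp add: o_def inv riem)
  ultimately show ?thesis
    using trace_orthonormal[OF lin iso metric_bilinear[OF C]] by simp
qed

text \<open>Tracing Ric = lam g over the 2n vectors of a real orthonormal frame gives R = 2n lam.
  The two Ricci terms add up because J is skew, and the argument is pointwise, so lam may
  vary.\<close>

lemma einstein_trace:
  assumes e: "local_unitary_frame \<A> g J C V e" and p: "p \<in> V" and E: "einstein \<A> g \<Gamma>"
  shows "1/2 * (\<Sum>b\<in>Basis. J C p (riem \<Gamma> C p X Y b) \<bullet> b)
    = scalar_curvature g \<Gamma> C p / (2 * real CARD('n)) * g C p (J C p X) Y"
proof -
  interpret kaehler_frame "snd C ` V" "\<lambda>x. g C (chart_inv C x)" "\<lambda>x. J C (chart_inv C x)"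
    "\<lambda>x. \<Gamma> C (chart_inv C x)" "\<lambda>x. e (chart_inv C x)"
    by (rule kaehler_frame_of_local_unitary_frame[OF e])
  have C: "C \<in> \<A>" "p \<in> fst C" and u: "unitary_frame g J C p (e p)"
    using e p by (auto simp: local_unitary_frame_def)
  have x: "snd C p \<in> snd C ` V" using p by simp
  have inv: "chart_inv C (snd C p) = p" by (rule chart_inv_left[OF C])
  obtain lam where lam: "\<And>Y Z. ricci \<Gamma> C p Y Z = lam * g C p Y Z"
    using E C unfolding einstein_def by blast
  have iso: "g C p (some_frame g C p v) (some_frame g C p w) = v \<bullet> w" for v w
    using some_frame_orthonormal[OF u] by (auto simp: orthonormal_frame_def)
  have scal: "scalar_curvature g \<Gamma> C p = lam * (2 * real CARD('n))"
    unfolding scalar_curvature_def lam iso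
    by (simp add: ebas_inner card_prod UNIV_Times_UNIV[symmetric]
        del: UNIV_Times_UNIV)
  have "(\<Sum>b\<in>Basis. J C p (riem \<Gamma> C p X Y b) \<bullet> b)
      = ricci \<Gamma> C p Y (J C p X) - ricci \<Gamma> C p X (J C p Y)"
    using trace_J_curv[OF x, of X Y] by (simp add: inv ricci_def riem_eq_curv[OF e p])
  also have "\<dots> = 2 * lam * g C p (J C p X) Y"
    using J_skew[OF x, of X Y] metric_sym[OF C, of Y "J C p X"] by (simp add: lam inv)
  finally show ?thesis by (simp add: scal)
qed

text \<open>Isolates the remaining geometric input: an identity between half the trace of J R and E
  applied to c^2 times the fundamental form. Keeping c and E general lets all the curvature
  equations share it.\<close>

lemma curvature_eqI:
  assumes psi: "\<And>C p u. C \<in> \<A> \<Longrightarrow> p \<in> fst C \<Longrightarrow> unitary_frame g J C p u \<Longrightarrow>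
      \<psi> C p u = c *\<^sub>R model_spinor"
    and E: "\<And>C V e p X Y. local_unitary_frame \<A> g J C V e \<Longrightarrow> p \<in> V \<Longrightarrow>
      1/2 * (\<Sum>b\<in>Basis. J C p (riem \<Gamma> C p X Y b) \<bullet> b)
        = E C p (\<lambda>X Y. c\<^sup>2 * g C p (J C p X) Y) X Y"
  shows "curvature_eq \<A> g J (canonical_aux_connection \<Gamma>) E \<psi>"
  unfolding curvature_eq_def
proof (intro allI impI ballI)
  fix C V e p X Y
  assume e: "local_unitary_frame \<A> g J C V e" and p: "p \<in> V"
  then have C: "C \<in> \<A>" "p \<in> fst C" and u: "unitary_frame g J C p (e p)"
    by (auto simp: local_unitary_frame_def)
  show "Theta12 (canonical_aux_connection \<Gamma>) C e p X Y = E C p (eta12 g \<psi> C p (e p)) X Y"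
    unfolding Theta12_eq_trace[OF e p] E[OF e p]
    by (simp only: eta12_fundamental_form[where \<psi> = \<psi> and c = c, OF C u psi[OF C u]])
qed

lemma clifford_monopoleI:
  assumes psi: "\<And>C p u. C \<in> \<A> \<Longrightarrow> p \<in> fst C \<Longrightarrow> unitary_frame g J C p u \<Longrightarrow>
      \<psi> C p u = c *\<^sub>R model_spinor"
    and E: "\<And>C V e p X Y. local_unitary_frame \<A> g J C V e \<Longrightarrow> p \<in> V \<Longrightarrow>
      1/2 * (\<Sum>b\<in>Basis. J C p (riem \<Gamma> C p X Y b) \<bullet> b)
        = E C p (\<lambda>X Y. c\<^sup>2 * g C p (J C p X) Y) X Y"
  shows "clifford_monopole \<A> g J \<Gamma> E \<psi> (canonical_aux_connection \<Gamma>)"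
  unfolding clifford_monopole_def
proof (intro conjI allI impI ballI)
  fix C V e p
  assume e: "local_unitary_frame \<A> g J C V e" and p: "p \<in> V"
  have psi_e: "\<psi> C q (e q) = c *\<^sub>R model_spinor" if "q \<in> V" for q
    by (rule psi) (use e that in \<open>auto simp: local_unitary_frame_def\<close>)
  show "dirac g \<Gamma> (canonical_aux_connection \<Gamma>) \<psi> C e p = 0"
    by (simp add: dirac_def spin_cov_model_spinor[where \<psi> = \<psi>, OF e p psi_e] cliff_zero_right)
qed (rule curvature_eqI[where c = c and \<psi> = \<psi> and E = E, OF psi E])

end

theorem mainTheorem8:
  fixes \<A> :: "('a::{t2_space, second_countable_topology}, 'n::{finite, linorder}) chart set"
    and g :: "('a, 'n) form2"
    and J :: "('a, 'n) endo"
    and \<Gamma> :: "('a, 'n) conn"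
    and \<sigma> :: "'n cmat \<Rightarrow> 'n twisted \<Rightarrow> 'n twisted"
    and \<phi> :: "('a, 'n) spinor_field"
    and \<theta> :: "('a, 'n) aux_conn"
  assumes kaehler: "kaehler_manifold \<A> g J \<Gamma>"
    and lift: "canonical_lift \<sigma>"
    and phi: "canonical_spinor \<A> g J \<sigma> \<phi>"
    and theta: "\<theta> = canonical_aux_connection \<Gamma>"
  shows "parallel_spinor \<A> g J \<Gamma> \<theta> \<phi>
    \<and> (\<forall>C\<in>\<A>. \<forall>p\<in>fst C. \<forall>u. unitary_frame g J C p u \<longrightarrow> eta12_hat g \<phi> C p u = J C p)
    \<and> curvature_eq \<A> g J \<theta> (\<lambda>C p \<eta> X Y. - curv_op g \<Gamma> C p \<eta> X Y) \<phi>
    \<and> clifford_monopole \<A> g J \<Gamma> (\<lambda>C p \<eta> X Y. - curv_op g \<Gamma> C p \<eta> X Y) \<phi> \<theta>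
    \<and> (einstein \<A> g \<Gamma> \<longrightarrow>
        curvature_eq \<A> g J \<theta>
          (\<lambda>C p \<eta> X Y. scalar_curvature g \<Gamma> C p / (2 * real CARD('n)) * \<eta> X Y) \<phi>
        \<and> (\<forall>s. (\<forall>C\<in>\<A>. \<forall>p\<in>fst C. scalar_curvature g \<Gamma> C p = s) \<longrightarrow>
            (s \<ge> 0 \<longrightarrow> clifford_monopole \<A> g J \<Gamma> (\<lambda>C p \<eta>. \<eta>)
               (\<lambda>C p u. sqrt (s / (2 * real CARD('n))) *\<^sub>R \<phi> C p u) \<theta>)
          \<and> (s \<le> 0 \<longrightarrow> clifford_monopole \<A> g J \<Gamma> (\<lambda>C p \<eta> X Y. - \<eta> X Y)
               (\<lambda>C p u. sqrt (- s / (2 * real CARD('n))) *\<^sub>R \<phi> C p u) \<theta>)))"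
proof -
  \<comment> \<open>The factor 1 gives the unscaled spinor the shape required by the lemmas with
    scale c.\<close>
  have model: "\<phi> C p u = 1 *\<^sub>R model_spinor"
    if "C \<in> \<A>" "p \<in> fst C" "unitary_frame g J C p u" for C p u
    using phi that by (simp add: canonical_spinor_def)
  have parallel: "parallel_spinor \<A> g J \<Gamma> \<theta> \<phi>"
    unfolding parallel_spinor_def theta
  proof (intro allI impI ballI)
    fix C V e p X
    assume e: "local_unitary_frame \<A> g J C V e" and p: "p \<in> V"
    show "spin_cov g \<Gamma> (canonical_aux_connection \<Gamma>) \<phi> C e p X = 0"
      by (rule spin_cov_model_spinor[OF kaehler e p, where c = 1], rule model)
        (use e in \<open>auto simp: local_unitary_frame_def\<close>)
  qed
  have hat: "\<forall>C\<in>\<A>. \<forall>p\<in>fst C. \<forall>u. unitary_frame g J C p u \<longrightarrow> eta12_hat g \<phi> C p u = J C p"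
    using eta12_hat_complex_structure[OF kaehler] model by simp
  have monopole: "clifford_monopole \<A> g J \<Gamma> (\<lambda>C p \<eta> X Y. - curv_op g \<Gamma> C p \<eta> X Y) \<phi> \<theta>"
    unfolding theta
  proof (rule clifford_monopoleI[OF kaehler, where c = 1], rule model)
    fix C V e p X Y
    assume e: "local_unitary_frame \<A> g J C V e" and p: "p \<in> V"
    show "1/2 * (\<Sum>b\<in>Basis. J C p (riem \<Gamma> C p X Y b) \<bullet> b)
        = - curv_op g \<Gamma> C p (\<lambda>X Y. 1\<^sup>2 * g C p (J C p X) Y) X Y"
      using curv_op_fundamental_form[OF kaehler e p, of X Y] by simp
  qed
  then have curvature: "curvature_eq \<A> g J \<theta> (\<lambda>C p \<eta> X Y. - curv_op g \<Gamma> C p \<eta> X Y) \<phi>"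
    by (simp add: clifford_monopole_def)
  have einstein: "curvature_eq \<A> g J \<theta>
        (\<lambda>C p \<eta> X Y. scalar_curvature g \<Gamma> C p / (2 * real CARD('n)) * \<eta> X Y) \<phi>
      \<and> (\<forall>s. (\<forall>C\<in>\<A>. \<forall>p\<in>fst C. scalar_curvature g \<Gamma> C p = s) \<longrightarrow>
          (s \<ge> 0 \<longrightarrow> clifford_monopole \<A> g J \<Gamma> (\<lambda>C p \<eta>. \<eta>)
             (\<lambda>C p u. sqrt (s / (2 * real CARD('n))) *\<^sub>R \<phi> C p u) \<theta>)
        \<and> (s \<le> 0 \<longrightarrow> clifford_monopole \<A> g J \<Gamma> (\<lambda>C p \<eta> X Y. - \<eta> X Y)
             (\<lambda>C p u. sqrt (- s / (2 * real CARD('n))) *\<^sub>R \<phi> C p u) \<theta>))"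
    if E: "einstein \<A> g \<Gamma>"
  proof (intro conjI allI impI)
    show "curvature_eq \<A> g J \<theta>
        (\<lambda>C p \<eta> X Y. scalar_curvature g \<Gamma> C p / (2 * real CARD('n)) * \<eta> X Y) \<phi>"
      unfolding theta
    proof (rule curvature_eqI[OF kaehler, where c = 1], rule model)
      fix C V e p X Y
      assume e: "local_unitary_frame \<A> g J C V e" and p: "p \<in> V"
      show "1/2 * (\<Sum>b\<in>Basis. J C p (riem \<Gamma> C p X Y b) \<bullet> b)
          = scalar_curvature g \<Gamma> C p / (2 * real CARD('n)) * (1\<^sup>2 * g C p (J C p X) Y)"
        using einstein_trace[OF kaehler e p E, of X Y] by simp
    qed
    fix s assume s: "\<forall>C\<in>\<A>. \<forall>p\<in>fst C. scalar_curvature g \<Gamma> C p = s"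
    have trace: "1/2 * (\<Sum>b\<in>Basis. J C p (riem \<Gamma> C p X Y b) \<bullet> b)
        = s / (2 * real CARD('n)) * g C p (J C p X) Y"
      if "local_unitary_frame \<A> g J C V e" "p \<in> V" for C V e p X Y
    proof -
      have "scalar_curvature g \<Gamma> C p = s"
        using s that by (auto simp: local_unitary_frame_def)
      then show ?thesis using einstein_trace[OF kaehler that E, of X Y] by simp
    qed
    \<comment> \<open>The scale is chosen so that c^2 = s / 2n, the Einstein constant.\<close>
    show "clifford_monopole \<A> g J \<Gamma> (\<lambda>C p \<eta>. \<eta>)
        (\<lambda>C p u. sqrt (s / (2 * real CARD('n))) *\<^sub>R \<phi> C p u) \<theta>" if "s \<ge> 0"
      unfolding theta
      by (rule clifford_monopoleI[OF kaehler, where c = "sqrt (s / (2 * real CARD('n)))"])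
        (use that in \<open>simp_all add: model trace[simplified]\<close>)
    \<comment> \<open>Now c^2 = - s / 2n, and the sign in E = - Id restores the Einstein
      constant.\<close>
    show "clifford_monopole \<A> g J \<Gamma> (\<lambda>C p \<eta> X Y. - \<eta> X Y)
        (\<lambda>C p u. sqrt (- s / (2 * real CARD('n))) *\<^sub>R \<phi> C p u) \<theta>" if "s \<le> 0"
      unfolding theta
      by (rule clifford_monopoleI[OF kaehler, where c = "sqrt (- s / (2 * real CARD('n)))"])
        (use that in \<open>simp_all add: model trace[simplified] divide_le_0_iff\<close>)
  qed
  show ?thesis
    using parallel hat curvature monopole einstein by blast
qed

end
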